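(* For every integer $k\ge0$ there exists a constant $C_{\Phi,k}>0$ such that, for all $\lambda\in V^*$, $X\in V$ and unit vectors $\xi_1,\dots,\xi_k\in V$, $$\left|D_{\xi_1}\cdots D_{\xi_k}\left(\frac{A_\lambda^\Phi}{\pi}\right)(X)\right|\le C_{\Phi,k}\,\|\lambda\|^k\sum_{w\in W}\ \prod_{\alpha\in\Phi^+}\frac{|\langle w\lambda,\alpha^\vee\rangle|}{1+|\alpha(X)|\,|\langle w\lambda,\alpha^\vee\rangle|}.$$
   Context: $V$ is a finite-dimensional Euclidean space with inner product $\langle\cdot,\cdot\rangle$, $V^*$ its dual; the inner product is used to identify $V$ with $V^*$ when convenient, $\|\cdot\|$ is the norm on either space, and $\langle\lambda,X\rangle=\lambda(X)$ for $\lambda\in V^*$, $X\in V$. $\Phi\subset V^*$ is a reduced crystallographic root system (not required to span $V^*$), $\Phi^+$ a positive system. For $\alpha\in\Phi$, $\alpha^\vee=2\alpha/\langle\alpha,\alpha\rangle$ and $s_\alpha X=X-\alpha(X)\alpha^\vee$. $W$ is the Weyl group generated by the $s_\alpha$, acting orthogonally on $V$ and $V^*$. The Weyl alternant is $A_\lambda^\Phi(X)=\sum_{w\in W}\det(w)e^{i\langle w\lambda,X\rangle}$, and $\pi(X)=\prod_{\alpha\in\Phi^+}\alpha(X)$. The quotient $A_\lambda^\Phi/\pi$, initially defined where $\pi\ne0$, has a unique smooth extension to all of $V$, denoted by the same symbol. $D_\xi$ is the directional derivative in the direction $\xi$. Convention: $0^0=1$. *)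

theory Defs
  imports "HOL-Analysis.Analysis"
begin

text \<open>The Euclidean space \<open>V\<close> is a type of class \<^class>\<open>euclidean_space\<close>, and the dual space is
  identified with \<open>V\<close> through the inner product. So roots and weights are elements of \<open>'a\<close>, the
  pairing of \<open>\<lambda>\<close> with \<open>X\<close> is \<open>\<lambda> \<bullet> X\<close>, and the two actions of the Weyl group coincide.\<close>

definition coroot :: "'a::real_inner \<Rightarrow> 'a" where
  "coroot \<alpha> = (2 / (\<alpha> \<bullet> \<alpha>)) *\<^sub>R \<alpha>"

definition root_reflection :: "'a::real_inner \<Rightarrow> 'a \<Rightarrow> 'a" where
  "root_reflection \<alpha> X = X - (\<alpha> \<bullet> X) *\<^sub>R coroot \<alpha>"

text \<open>The roots are not required to span, and the empty root system is allowed.\<close>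

definition reduced_root_system :: "'a::euclidean_space set \<Rightarrow> bool" where
  "reduced_root_system \<Phi> \<longleftrightarrow>
     finite \<Phi> \<and> 0 \<notin> \<Phi> \<and>
     (\<forall>\<alpha>\<in>\<Phi>. \<forall>\<beta>\<in>\<Phi>. root_reflection \<alpha> \<beta> \<in> \<Phi>) \<and>
     (\<forall>\<alpha>\<in>\<Phi>. \<forall>\<beta>\<in>\<Phi>. \<beta> \<bullet> coroot \<alpha> \<in> \<int>) \<and>
     (\<forall>\<alpha>\<in>\<Phi>. \<forall>c::real. c *\<^sub>R \<alpha> \<in> \<Phi> \<longrightarrow> c = 1 \<or> c = -1)"

definition positive_system :: "'a::euclidean_space set \<Rightarrow> 'a set \<Rightarrow> bool" where
  "positive_system \<Phi> P \<longleftrightarrow>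
     (\<exists>v. (\<forall>\<alpha>\<in>\<Phi>. \<alpha> \<bullet> v \<noteq> 0) \<and> P = {\<alpha>\<in>\<Phi>. \<alpha> \<bullet> v > 0})"

text \<open>Reflections are involutions, so the monoid they generate is already a group.\<close>

inductive_set weyl_group :: "'a::euclidean_space set \<Rightarrow> ('a \<Rightarrow> 'a) set" for \<Phi> where
  one: "id \<in> weyl_group \<Phi>"
| step: "\<alpha> \<in> \<Phi> \<Longrightarrow> w \<in> weyl_group \<Phi> \<Longrightarrow> root_reflection \<alpha> \<circ> w \<in> weyl_group \<Phi>"

text \<open>The determinant of an endomorphism: the Leibniz formula for its matrix with respect to the
  orthonormal basis \<^const>\<open>Basis\<close>. The library's \<^const>\<open>det\<close> covers only matrices indexed
  by a finite type; the lemma below shows that the two agree on \<open>real^'n\<close>.\<close>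

definition lin_det :: "('a::euclidean_space \<Rightarrow> 'a) \<Rightarrow> real" where
  "lin_det f = (\<Sum>p | p permutes (Basis :: 'a set). of_int (sign p) * (\<Prod>b\<in>Basis. b \<bullet> f (p b)))"

lemma lin_det_eq_det: "lin_det f = det (matrix f)" for f :: "real^'n \<Rightarrow> real^'n"
proof -
  let ?e = "\<lambda>i::'n. axis i (1::real)"
  let ?m = "map_permutation UNIV ?e"
  let ?g = "axis_index :: real^'n \<Rightarrow> 'n"
  have e: "bij_betw ?e UNIV Basis" "inj ?e"
    by (auto simp: bij_betw_def inj_on_def axis_eq_axis Basis_vec_def)
  have g: "?g (?e i) = i" for i
    by (simp add: axis_index_def axis_eq_axis)
  have g': "bij_betw ?g Basis UNIV"
    using bij_betw_inv_into[OF e(1)] g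
    by (metis (no_types, lifting) bij_betw_cong bij_betw_inv_into_right[OF e(1)])
  have eg: "?e (?g b) = b" if "b \<in> Basis" for b
  proof -
    from that obtain i where "b = ?e i" by (auto simp: Basis_vec_def)
    then show ?thesis using g by simp
  qed
  have "lin_det f = (\<Sum>p | p permutes (UNIV::'n set).
      of_int (sign (?m p)) * (\<Prod>b\<in>Basis. b \<bullet> f (?m p b)))"
    unfolding lin_det_def
    by (rule sum.reindex_bij_witness[where i = ?m and j = "map_permutation Basis ?g"])
       (use map_permutation_compose_inv[OF g', where g = ?e]
            map_permutation_compose_inv[OF e(1), where g = ?g]
            map_permutation_permutes[OF g'] map_permutation_permutes[OF e(1)] g eg in auto)
  also have "\<dots> = (\<Sum>p | p permutes (UNIV::'n set).
      of_int (sign p) * (\<Prod>i\<in>UNIV. matrix f $ i $ p i))"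
  proof (intro sum.cong refl)
    fix p :: "'n \<Rightarrow> 'n" assume "p \<in> {p. p permutes UNIV}"
    then have p: "p permutes UNIV" by simp
    have "(\<Prod>b\<in>Basis. b \<bullet> f (?m p b)) = (\<Prod>i\<in>UNIV. ?e i \<bullet> f (?m p (?e i)))"
      using prod.reindex_bij_betw[OF e(1), symmetric] .
    moreover have "?m p (?e i) = ?e (p i)" for i
      using map_permutation_apply[OF e(2)] by simp
    ultimately show "of_int (sign (?m p)) * (\<Prod>b\<in>Basis. b \<bullet> f (?m p b)) =
        of_int (sign p) * (\<Prod>i\<in>UNIV. matrix f $ i $ p i)"
      using sign_map_permutation[OF e(2) p] by (simp add: matrix_def inner_axis')
  qed
  finally show ?thesis by (simp add: det_def)
qed

definition weyl_alternant :: "'a::euclidean_space set \<Rightarrow> 'a \<Rightarrow> 'a \<Rightarrow> complex" where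
  "weyl_alternant \<Phi> l X =
     (\<Sum>w\<in>weyl_group \<Phi>. of_real (lin_det w) * exp (\<i> * of_real (w l \<bullet> X)))"

definition root_product :: "'a::euclidean_space set \<Rightarrow> 'a \<Rightarrow> real" where
  "root_product P X = (\<Prod>\<alpha>\<in>P. \<alpha> \<bullet> X)"

definition dir_deriv ::
  "'a::real_normed_vector \<Rightarrow> ('a \<Rightarrow> 'b::real_normed_vector) \<Rightarrow> 'a \<Rightarrow> 'b" where
  "dir_deriv \<xi> f X = vector_derivative (\<lambda>t. f (X + t *\<^sub>R \<xi>)) (at 0)"

primrec C_k ::
  "nat \<Rightarrow> ('a::real_normed_vector \<Rightarrow> 'b::real_normed_vector) \<Rightarrow> bool" where
  "C_k 0 f \<longleftrightarrow> continuous_on UNIV f"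
| "C_k (Suc n) f \<longleftrightarrow> (\<forall>X. f differentiable (at X)) \<and> (\<forall>\<xi>. C_k n (dir_deriv \<xi> f))"

definition smooth :: "('a::real_normed_vector \<Rightarrow> 'b::real_normed_vector) \<Rightarrow> bool" where
  "smooth f \<longleftrightarrow> (\<forall>n. C_k n f)"

definition weyl_quotient :: "'a::euclidean_space set \<Rightarrow> 'a set \<Rightarrow> 'a \<Rightarrow> 'a \<Rightarrow> complex" where
  "weyl_quotient \<Phi> P l = (THE F. smooth F \<and>
     (\<forall>X. root_product P X \<noteq> 0 \<longrightarrow> F X = weyl_alternant \<Phi> l X / of_real (root_product P X)))"

end

theory Submission
  imports Defs "HOL-Complex_Analysis.Complex_Analysis"
begin

text \<open>
Write \<open>\<phi>(t) = t / (1 + t)\<close>, called \<open>damp\<close> below. Since \<open>\<alpha>\<^sup>\<or>\<close> is a fixed multiple of \<open>\<alpha>\<close>, the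
case \<open>k = 0\<close>, multiplied by \<open>|\<pi>(X)|\<close>, says that \<open>|A\<^sub>\<lambda>(X)|\<close> is at most a constant times the sum over \<open>w\<close> of
\<open>\<Prod> \<phi>(|\<alpha>(X)| |\<langle>w\<lambda>, \<alpha>\<rangle>|)\<close>. This is proved for \<^emph>\<open>complex\<close> \<open>\<lambda>\<close> and \<open>X\<close>, under the sole condition
that all \<open>|Im \<langle>w\<lambda>, X\<rangle>|\<close> are bounded by a given \<open>R\<close> (\<open>alternant_estimate\<close>). The derivatives are then
free. The quotient extends to a holomorphic function on the complexified space
(\<open>exists_holo_quotient\<close>); for real \<open>\<lambda>\<close> and \<open>X\<close>, complex points within distance \<open>O(1 / \<parallel>\<lambda>\<parallel>)\<close> of \<open>X\<close>
satisfy the condition, and the right hand side changes only by a constant factor there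
(\<open>quotient_estimate_regular\<close>); so Cauchy's inequality on circles of radius \<open>1 / \<parallel>\<lambda>\<parallel>\<close> produces one factor
\<open>\<parallel>\<lambda>\<parallel>\<close> for each derivative (\<open>iterated_Cauchy_estimate\<close>).

The estimate of the alternant goes by induction on the number of roots. It is invariant under
\<open>(\<lambda>, X) \<mapsto> (m\<lambda>, X / m)\<close>, so let the largest \<open>|\<alpha>(X)|\<close> be \<open>1\<close>. Two observations are combined.

\<^item> \<open>A\<^sub>\<lambda>(X)\<close> vanishes as a function of \<open>\<lambda>\<close> on every root hyperplane. The maximum principle on a complex line
  through \<open>\<lambda>\<close>, in a direction \<open>\<eta>\<close> transverse to the hyperplanes, bounds \<open>|A\<^sub>\<lambda>(X)|\<close> by
  \<open>\<Prod> min(1, |\<langle>\<lambda>, \<alpha>\<rangle>|)\<close> times its maximum at the points \<open>\<lambda> + z\<eta>\<close>, \<open>|z| = 2\<close> (\<open>calternant_gain\<close>).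

\<^item> For a suitable threshold the roots that are small at \<open>X\<close> form a set \<open>\<Psi>\<close> closed under reflections
  (\<open>exists_reflection_closed_sublevel\<close>). The alternant of \<open>\<Phi>\<close> is a sum,
  with signs, of alternants of \<open>\<Psi>\<close> at points \<open>w\<lambda>\<close> (\<open>calternant_subsystem\<close>), to which the induction hypothesis applies.

Apply the second at \<open>\<lambda> + z\<eta>\<close>. Put \<open>a = |\<alpha>(X)| \<le> 1\<close> and \<open>b = |\<langle>w\<lambda>, \<alpha>\<rangle>|\<close>. The displacement changes \<open>b\<close> by
a bounded amount, so for \<open>\<alpha>\<close> in \<open>\<Psi>\<close> the induction hypothesis gives a factor \<open>a (1 + b) / (1 + a b)\<close>
instead of \<open>\<phi>(a b) = a b / (1 + a b)\<close>. The gain, which is of size \<open>\<phi>(b)\<close>, corrects precisely this: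
\<open>\<phi>(b) a (1 + b) / (1 + a b) = \<phi>(a b)\<close>. For \<open>\<alpha>\<close> outside \<open>\<Psi>\<close> there is no factor from the induction
hypothesis, but \<open>a\<close> is bounded below and \<open>\<phi>(b)\<close> is already comparable to \<open>\<phi>(a b)\<close>
(\<open>alternant_induction_step\<close>).
\<close>

section \<open>Determinants of reflections\<close>

text \<open>A finite index type for the orthonormal basis identifies \<^const>\<open>lin_det\<close> with the determinant of a
matrix, so that its multiplicativity need not be proved from the Leibniz formula again.\<close>

typedef (overloaded) 'a basis_index = "Basis :: 'a::euclidean_space set"
  morphisms basis_vector basis_index
  using nonempty_Basis by blast

instance basis_index :: (euclidean_space) finite
proof
  have "(UNIV :: 'a basis_index set) \<subseteq> basis_index ` Basis"
    using basis_vector basis_vector_inverse by (metis image_eqI subsetI)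
  then show "finite (UNIV :: 'a basis_index set)"
    using finite_Basis finite_subset by blast
qed

lemma bij_basis_vector: "bij_betw (basis_vector :: 'a::euclidean_space basis_index \<Rightarrow> 'a) UNIV Basis"
  by (rule bij_betw_byWitness[where f' = basis_index])
    (auto simp: basis_vector basis_vector_inverse basis_index_inverse)

text \<open>A bijection between \<^const>\<open>Basis\<close> and the index type transports permutations together with their
signs, so the two Leibniz sums agree term by term.\<close>

lemma lin_det_eq_det_basis:
  fixes f :: "'a::euclidean_space \<Rightarrow> 'a"
  shows "lin_det f = det (\<chi> i j :: 'a basis_index. basis_vector i \<bullet> f (basis_vector j))"
proof -
  let ?e = "basis_vector :: 'a basis_index \<Rightarrow> 'a"
  let ?g = "basis_index :: 'a \<Rightarrow> 'a basis_index"
  let ?m = "map_permutation UNIV ?e"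
  have e: "bij_betw ?e UNIV Basis" by (rule bij_basis_vector)
  have inj: "inj ?e" using e by (simp add: bij_betw_def)
  have g: "?g (?e i) = i" for i by (rule basis_vector_inverse)
  have eg: "?e (?g b) = b" if "b \<in> Basis" for b using that by (rule basis_index_inverse)
  have g': "bij_betw ?g Basis UNIV"
    by (rule bij_betw_byWitness[where f' = ?e]) (auto simp: g eg basis_vector)
  have "lin_det f = (\<Sum>p | p permutes (UNIV::'a basis_index set).
      of_int (sign (?m p)) * (\<Prod>b\<in>Basis. b \<bullet> f (?m p b)))"
    unfolding lin_det_def
    by (rule sum.reindex_bij_witness[where i = ?m and j = "map_permutation Basis ?g"])
       (use map_permutation_compose_inv[OF g', where g = ?e]
            map_permutation_compose_inv[OF e, where g = ?g]
            map_permutation_permutes[OF g'] map_permutation_permutes[OF e] g eg in auto)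
  also have "\<dots> = (\<Sum>p | p permutes (UNIV::'a basis_index set).
      of_int (sign p) * (\<Prod>i\<in>UNIV. ?e i \<bullet> f (?e (p i))))"
  proof (intro sum.cong refl)
    fix p :: "'a basis_index \<Rightarrow> 'a basis_index" assume "p \<in> {p. p permutes UNIV}"
    then have p: "p permutes UNIV" by simp
    have "(\<Prod>b\<in>Basis. b \<bullet> f (?m p b)) = (\<Prod>i\<in>UNIV. ?e i \<bullet> f (?m p (?e i)))"
      using prod.reindex_bij_betw[OF e, symmetric] .
    moreover have "?m p (?e i) = ?e (p i)" for i
      using map_permutation_apply[OF inj] by simp
    ultimately show "of_int (sign (?m p)) * (\<Prod>b\<in>Basis. b \<bullet> f (?m p b)) =
        of_int (sign p) * (\<Prod>i\<in>UNIV. ?e i \<bullet> f (?e (p i)))"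
      using sign_map_permutation[OF inj p] by simp
  qed
  finally show ?thesis by (simp add: det_def)
qed

lemma lin_det_compose:
  fixes f g :: "'a::euclidean_space \<Rightarrow> 'a"
  assumes "linear f"
  shows "lin_det (f \<circ> g) = lin_det f * lin_det g"
proof -
  let ?e = "basis_vector :: 'a basis_index \<Rightarrow> 'a"
  have *: "?e i \<bullet> f (g (?e j)) = (\<Sum>k\<in>UNIV. (?e i \<bullet> f (?e k)) * (?e k \<bullet> g (?e j)))" for i j
  proof -
    have "f (g (?e j)) = f (\<Sum>b\<in>Basis. (g (?e j) \<bullet> b) *\<^sub>R b)"
      by (simp only: euclidean_representation)
    also have "\<dots> = (\<Sum>b\<in>Basis. (g (?e j) \<bullet> b) *\<^sub>R f b)"
      using assms by (simp add: linear_sum linear_scale)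
    also have "\<dots> = (\<Sum>k\<in>UNIV. (g (?e j) \<bullet> ?e k) *\<^sub>R f (?e k))"
      using sum.reindex_bij_betw[OF bij_basis_vector, symmetric] .
    finally show ?thesis
      by (simp add: inner_sum_right inner_commute mult.commute)
  qed
  have "(\<chi> i j. ?e i \<bullet> (f \<circ> g) (?e j)) = (\<chi> i j. ?e i \<bullet> f (?e j)) ** (\<chi> i j. ?e i \<bullet> g (?e j))"
    by (simp add: matrix_matrix_mult_def *)
  then show ?thesis
    by (simp add: lin_det_eq_det_basis det_mul)
qed

lemma lin_det_id: "lin_det (id :: 'a::euclidean_space \<Rightarrow> 'a) = 1"
proof -
  let ?e = "basis_vector :: 'a basis_index \<Rightarrow> 'a"
  have "(\<chi> i j. ?e i \<bullet> id (?e j)) = mat 1"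
    by (simp add: mat_def inner_Basis basis_vector basis_vector_inject vec_eq_iff)
  then show ?thesis by (simp add: lin_det_eq_det_basis)
qed

lemma root_reflection_eq: "root_reflection \<alpha> x = x - (2 * (\<alpha> \<bullet> x) / (\<alpha> \<bullet> \<alpha>)) *\<^sub>R \<alpha>"
  by (simp add: root_reflection_def coroot_def)

lemma linear_root_reflection: "linear (root_reflection \<alpha>)"
  by (rule linearI) (simp_all add: root_reflection_eq algebra_simps add_divide_distrib)

lemma root_reflection_adjoint: "root_reflection \<alpha> x \<bullet> y = x \<bullet> root_reflection \<alpha> y"
  by (simp add: root_reflection_eq algebra_simps inner_commute)

lemma root_reflection_involution: "root_reflection \<alpha> (root_reflection \<alpha> x) = x"
  by (cases "\<alpha> = 0") (simp_all add: root_reflection_eq algebra_simps field_simps)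

lemma root_reflection_inner: "root_reflection \<alpha> x \<bullet> root_reflection \<alpha> y = x \<bullet> y"
  by (simp add: root_reflection_adjoint root_reflection_involution)

lemma root_reflection_scaleR: "c \<noteq> 0 \<Longrightarrow> root_reflection (c *\<^sub>R \<alpha>) = root_reflection \<alpha>"
  by (auto simp: root_reflection_eq fun_eq_iff)

lemma root_reflection_conjugate:
  "root_reflection \<beta> \<circ> root_reflection \<alpha> \<circ> root_reflection \<beta> = root_reflection (root_reflection \<beta> \<alpha>)"
  (is "?r \<circ> _ \<circ> _ = _")
proof
  fix x
  have "?r (root_reflection \<alpha> (?r x)) = ?r (?r x) - (2 * (\<alpha> \<bullet> ?r x) / (\<alpha> \<bullet> \<alpha>)) *\<^sub>R ?r \<alpha>"
    by (simp add: root_reflection_eq[of \<alpha>] linear_diff linear_scale linear_root_reflection)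
  then show "(?r \<circ> root_reflection \<alpha> \<circ> ?r) x = root_reflection (?r \<alpha>) x"
    by (simp add: root_reflection_eq[of "?r \<alpha>"] root_reflection_involution root_reflection_adjoint
        root_reflection_inner)
qed

text \<open>The Householder reflection that exchanges two vectors of equal length.\<close>

lemma root_reflection_swap:
  assumes "norm a = norm b" "a \<noteq> b"
  shows "root_reflection (a - b) a = b"
proof -
  have "a \<bullet> a = b \<bullet> b" using assms(1) by (simp add: norm_eq)
  then have "(a - b) \<bullet> (a - b) = 2 * ((a - b) \<bullet> a)"
    by (simp add: algebra_simps inner_commute)
  moreover have nz: "(a - b) \<bullet> (a - b) \<noteq> 0"
    using assms(2) by (metis eq_iff_diff_eq_0 inner_eq_zero_iff)
  ultimately have "2 * ((a - b) \<bullet> a) / ((a - b) \<bullet> (a - b)) = 1"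
    by (simp only: divide_self[OF nz] flip: \<open>(a - b) \<bullet> (a - b) = _\<close>)
  then have "root_reflection (a - b) a = a - 1 *\<^sub>R (a - b)"
    by (simp only: root_reflection_eq)
  then show ?thesis by simp
qed

lemma lin_det_basis_reflection:
  fixes b :: "'a::euclidean_space"
  assumes "b \<in> Basis"
  shows "lin_det (root_reflection b) = -1"
proof -
  let ?e = "basis_vector :: 'a basis_index \<Rightarrow> 'a"
  let ?A = "\<chi> i j. ?e i \<bullet> root_reflection b (?e j)"
  obtain k where k: "b = ?e k"
    using assms bij_basis_vector by (metis basis_index_inverse)
  have A: "?A $ i $ j = (if i = j then if i = k then -1 else 1 else 0)" for i j
    by (simp add: root_reflection_eq k inner_diff_right inner_Basis basis_vector basis_vector_inject)
  have "det ?A = (\<Prod>i\<in>UNIV. ?A $ i $ i)"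
    by (rule det_diagonal) (simp only: A if_False)
  also have "\<dots> = -1"
    by (simp only: A simp_thms if_True) simp
  finally show ?thesis by (simp add: lin_det_eq_det_basis)
qed

text \<open>A Householder reflection conjugates the reflection in \<open>\<alpha>\<close> to the reflection in a basis vector,
whose matrix is diagonal with a single entry \<open>-1\<close>.\<close>

lemma lin_det_root_reflection:
  fixes \<alpha> :: "'a::euclidean_space"
  assumes "\<alpha> \<noteq> 0"
  shows "lin_det (root_reflection \<alpha>) = -1"
proof -
  obtain b :: 'a where b: "b \<in> Basis" using nonempty_Basis by blast
  define a where "a = norm \<alpha> *\<^sub>R b"
  have a: "norm a = norm \<alpha>" "root_reflection a = root_reflection b"
    using b assms by (auto simp: a_def root_reflection_scaleR)
  show ?thesis
  proof (cases "\<alpha> = a")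
    case True
    then show ?thesis using a lin_det_basis_reflection[OF b] by simp
  next
    case False
    let ?r = "root_reflection (\<alpha> - a)"
    have rr: "?r \<circ> ?r = id" by (auto simp: root_reflection_involution)
    have "lin_det ?r * lin_det ?r = 1"
      using lin_det_compose[OF linear_root_reflection, of "\<alpha> - a" ?r] rr lin_det_id by metis
    moreover have "lin_det ?r * (lin_det (root_reflection \<alpha>) * lin_det ?r) = -1"
      using lin_det_compose[OF linear_root_reflection, of "\<alpha> - a" "root_reflection \<alpha> \<circ> ?r"]
        lin_det_compose[OF linear_root_reflection, of \<alpha> ?r]
        root_reflection_conjugate[of "\<alpha> - a" \<alpha>] root_reflection_swap[of \<alpha> a] a False
        lin_det_basis_reflection[OF b]
      by (simp add: comp_assoc)
    ultimately show ?thesis by (metis mult.assoc mult.commute mult_1)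
  qed
qed

section \<open>The Weyl group\<close>

lemma root_nonzero: "reduced_root_system \<Phi> \<Longrightarrow> \<alpha> \<in> \<Phi> \<Longrightarrow> \<alpha> \<noteq> 0"
  by (auto simp: reduced_root_system_def)

lemma weyl_group_linear: "w \<in> weyl_group \<Phi> \<Longrightarrow> linear w"
  by (induction rule: weyl_group.induct)
    (auto intro: linear_compose linear_root_reflection linear_id[unfolded id_def] simp: id_def simp del: comp_apply)

lemma weyl_group_inner: "w \<in> weyl_group \<Phi> \<Longrightarrow> w x \<bullet> w y = x \<bullet> y"
  by (induction rule: weyl_group.induct) (auto simp: root_reflection_inner)

lemma weyl_group_norm: "w \<in> weyl_group \<Phi> \<Longrightarrow> norm (w x) = norm x"
  by (simp add: norm_eq_sqrt_inner weyl_group_inner)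

lemma weyl_group_compose:
  "w \<in> weyl_group \<Phi> \<Longrightarrow> v \<in> weyl_group \<Phi> \<Longrightarrow> w \<circ> v \<in> weyl_group \<Phi>"
  by (induction rule: weyl_group.induct) (auto simp: comp_assoc intro: weyl_group.intros)

lemma weyl_group_reflection: "\<alpha> \<in> \<Phi> \<Longrightarrow> root_reflection \<alpha> \<in> weyl_group \<Phi>"
  using weyl_group.step[OF _ weyl_group.one] by simp

lemma weyl_group_mono: "\<Psi> \<subseteq> \<Phi> \<Longrightarrow> w \<in> weyl_group \<Psi> \<Longrightarrow> w \<in> weyl_group \<Phi>"
  by (rotate_tac, induction rule: weyl_group.induct) (auto intro: weyl_group.intros)

lemma weyl_group_empty: "weyl_group {} = {id}"
proof -
  have "w = id" if "w \<in> weyl_group {}" for w :: "'a \<Rightarrow> 'a"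
    using that by (induction rule: weyl_group.induct) auto
  then show ?thesis using weyl_group.one by blast
qed

lemma weyl_group_inverse:
  assumes "w \<in> weyl_group \<Phi>"
  obtains v where "v \<in> weyl_group \<Phi>" "v \<circ> w = id" "w \<circ> v = id"
proof -
  have "\<exists>v\<in>weyl_group \<Phi>. v \<circ> w = id \<and> w \<circ> v = id"
    using assms
  proof (induction rule: weyl_group.induct)
    case one
    then show ?case by (metis comp_id weyl_group.one)
  next
    case (step \<alpha> w)
    then obtain v where v: "v \<in> weyl_group \<Phi>" "v \<circ> w = id" "w \<circ> v = id" by blast
    have "v \<circ> root_reflection \<alpha> \<in> weyl_group \<Phi>"
      using v step by (simp add: weyl_group_compose weyl_group_reflection)
    moreover have "v (w x) = x" "w (v x) = x" for x
      using v by (auto simp: fun_eq_iff)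
    ultimately show ?case
      by (intro bexI[of _ "v \<circ> root_reflection \<alpha>"]) (auto simp: fun_eq_iff root_reflection_involution)
  qed
  then show ?thesis using that by blast
qed

lemma weyl_group_adjoint:
  assumes "w \<in> weyl_group \<Phi>" "v \<circ> w = id"  "w \<circ> v = id"
  shows "w x \<bullet> y = x \<bullet> v y"
  using weyl_group_inner[OF assms(1), of x "v y"] assms(3) by (simp add: fun_eq_iff)

lemma bij_betw_weyl_group_compose_left:
  assumes "w \<in> weyl_group \<Phi>"
  shows "bij_betw (\<lambda>v. w \<circ> v) (weyl_group \<Phi>) (weyl_group \<Phi>)"
proof -
  obtain w' where w': "w' \<in> weyl_group \<Phi>" "w' \<circ> w = id" "w \<circ> w' = id"
    using weyl_group_inverse[OF assms] .
  show ?thesis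
    by (rule bij_betw_byWitness[where f' = "\<lambda>v. w' \<circ> v"])
      (use w' assms in \<open>auto intro: weyl_group_compose simp flip: comp_assoc\<close>)
qed

lemma bij_betw_weyl_group_compose_right:
  assumes "w \<in> weyl_group \<Phi>"
  shows "bij_betw (\<lambda>v. v \<circ> w) (weyl_group \<Phi>) (weyl_group \<Phi>)"
proof -
  obtain w' where w': "w' \<in> weyl_group \<Phi>" "w' \<circ> w = id" "w \<circ> w' = id"
    using weyl_group_inverse[OF assms] .
  show ?thesis
    by (rule bij_betw_byWitness[where f' = "\<lambda>v. v \<circ> w'"])
      (use w' assms in \<open>auto intro: weyl_group_compose simp: comp_assoc\<close>)
qed

lemma weyl_group_roots:
  assumes "reduced_root_system \<Phi>" "w \<in> weyl_group \<Phi>" "\<alpha> \<in> \<Phi>"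
  shows "w \<alpha> \<in> \<Phi>"
  using assms(2,1,3)
  by (induction rule: weyl_group.induct) (auto simp: reduced_root_system_def)

lemma bij_betw_weyl_group_roots:
  assumes "reduced_root_system \<Phi>" "w \<in> weyl_group \<Phi>"
  shows "bij_betw w \<Phi> \<Phi>"
proof -
  obtain w' where w': "w' \<in> weyl_group \<Phi>" "w' \<circ> w = id" "w \<circ> w' = id"
    using weyl_group_inverse[OF assms(2)] .
  show ?thesis
    by (rule bij_betw_byWitness[where f' = w'])
      (use w' weyl_group_roots[OF assms(1)] assms(2) in \<open>auto simp: fun_eq_iff\<close>)
qed

lemma weyl_group_fixes_orthogonal:
  assumes "w \<in> weyl_group \<Phi>" "\<And>\<alpha>. \<alpha> \<in> \<Phi> \<Longrightarrow> \<alpha> \<bullet> x = 0"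
  shows "w x = x"
  using assms by (induction rule: weyl_group.induct) (auto simp: root_reflection_eq)

text \<open>An element of the group is determined by the permutation of the roots that it induces,
because it fixes the orthogonal complement of the roots pointwise.\<close>

lemma finite_weyl_group:
  assumes "reduced_root_system \<Phi>"
  shows "finite (weyl_group \<Phi>)"
proof -
  have fin: "finite \<Phi>" using assms by (simp add: reduced_root_system_def)
  have "inj_on (\<lambda>w. restrict w \<Phi>) (weyl_group \<Phi>)"
  proof (rule inj_onI)
    fix w v assume wv: "w \<in> weyl_group \<Phi>" "v \<in> weyl_group \<Phi>" "restrict w \<Phi> = restrict v \<Phi>"
    have lin: "linear w" "linear v" using wv weyl_group_linear by auto
    have eq: "w \<alpha> = v \<alpha>" if "\<alpha> \<in> \<Phi>" for \<alpha>
      using wv(3) that by (metis restrict_apply')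
    have span: "w y = v y" if "y \<in> span \<Phi>" for y
      using linear_eq_on[OF lin that] eq by blast
    show "w = v"
    proof
      fix x
      obtain y z where yz: "y \<in> span \<Phi>" "\<And>u. u \<in> span \<Phi> \<Longrightarrow> orthogonal z u" "x = y + z"
        using orthogonal_subspace_decomp_exists[of \<Phi> x] by blast
      have "\<alpha> \<bullet> z = 0" if "\<alpha> \<in> \<Phi>" for \<alpha>
        using yz(2)[of \<alpha>] that by (simp add: span_base orthogonal_def inner_commute)
      then have "w z = z" "v z = z"
        using weyl_group_fixes_orthogonal wv by blast+
      then show "w x = v x"
        using span[OF yz(1)] lin by (simp add: yz(3) linear_add)
    qed
  qed
  moreover have "(\<lambda>w. restrict w \<Phi>) ` weyl_group \<Phi> \<subseteq> \<Phi> \<rightarrow>\<^sub>E \<Phi>"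
    using weyl_group_roots[OF assms] by (auto simp: PiE_iff)
  ultimately show ?thesis
    using fin by (meson finite_PiE finite_imageD finite_subset)
qed

lemma lin_det_weyl_group:
  assumes "reduced_root_system \<Phi>" "w \<in> weyl_group \<Phi>"
  shows "\<bar>lin_det w\<bar> = 1"
  using assms(2)
proof (induction rule: weyl_group.induct)
  case (step \<alpha> w)
  then have "\<alpha> \<noteq> 0" using assms(1) by (auto simp: reduced_root_system_def)
  then show ?case
    using step lin_det_compose[OF linear_root_reflection, of \<alpha> w]
    by (simp add: lin_det_root_reflection abs_mult del: comp_apply)
qed (simp add: lin_det_id[unfolded id_def] id_def)

lemma positive_system_choice:
  assumes "reduced_root_system \<Phi>" "positive_system \<Phi> P"
  shows "P \<subseteq> \<Phi>" "finite P" "uminus ` P \<inter> P = {}" "\<Phi> = P \<union> uminus ` P"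
proof -
  obtain v where v: "\<forall>\<alpha>\<in>\<Phi>. \<alpha> \<bullet> v \<noteq> 0" "P = {\<alpha>\<in>\<Phi>. \<alpha> \<bullet> v > 0}"
    using assms(2) by (auto simp: positive_system_def)
  show "P \<subseteq> \<Phi>" using v by auto
  then show "finite P"
    using assms(1) finite_subset by (auto simp: reduced_root_system_def)
  show "uminus ` P \<inter> P = {}" using v by auto
  have neg: "- \<alpha> \<in> \<Phi>" if "\<alpha> \<in> \<Phi>" for \<alpha>
  proof -
    have "\<alpha> \<noteq> 0" using that assms(1) by (auto simp: reduced_root_system_def)
    then have "root_reflection \<alpha> \<alpha> = - \<alpha>"
      by (simp add: root_reflection_eq) (metis add_diff_cancel_left' minus_diff_eq scaleR_2)
    then show ?thesis using that assms(1) by (metis reduced_root_system_def)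
  qed
  show "\<Phi> = P \<union> uminus ` P"
  proof (intro equalityI subsetI)
    fix \<alpha> assume a: "\<alpha> \<in> \<Phi>"
    show "\<alpha> \<in> P \<union> uminus ` P"
    proof (cases "\<alpha> \<bullet> v > 0")
      case False
      then have "- \<alpha> \<in> P" using v a neg[OF a] by force
      then show ?thesis by (metis UnI2 image_eqI minus_minus)
    qed (use a v in auto)
  qed (use v neg in auto)
qed

text \<open>This is where reducedness enters: the hyperplanes of distinct positive roots are distinct.\<close>

lemma positive_not_proportional:
  assumes "reduced_root_system \<Phi>" "positive_system \<Phi> P" "\<alpha> \<in> P" "\<beta> \<in> P" "\<alpha> \<noteq> \<beta>"
  shows "\<beta> \<noteq> c *\<^sub>R \<alpha>"
proof
  assume c: "\<beta> = c *\<^sub>R \<alpha>"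
  note P = positive_system_choice[OF assms(1,2)]
  have "c = 1 \<or> c = -1"
    using assms(1,3,4) P(1) c unfolding reduced_root_system_def by blast
  then have "\<beta> = - \<alpha>" using assms(5) c by auto
  then show False using P(3) assms(3,4) by blast
qed

lemma positive_system_subset:
  assumes "positive_system \<Phi> P" "\<Psi> \<subseteq> \<Phi>"
  shows "positive_system \<Psi> (P \<inter> \<Psi>)"
proof -
  obtain v where "\<forall>\<alpha>\<in>\<Phi>. \<alpha> \<bullet> v \<noteq> 0" "P = {\<alpha>\<in>\<Phi>. \<alpha> \<bullet> v > 0}"
    using assms(1) by (auto simp: positive_system_def)
  then show ?thesis using assms(2) unfolding positive_system_def by (intro exI[of _ v]) auto
qed

text \<open>The elements of the Weyl group permute the pairs \<open>{\<alpha>, -\<alpha>}\<close>, so a product of an even function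
over the positive roots is invariant. To see it without tracking signs, square the product: the
square is the product over all roots, which is visibly invariant.\<close>

lemma prod_positive_weyl_invariant:
  fixes f :: "'a::euclidean_space \<Rightarrow> real"
  assumes rs: "reduced_root_system \<Phi>" "positive_system \<Phi> P" and w: "w \<in> weyl_group \<Phi>"
    and even: "\<And>\<alpha>. f (- \<alpha>) = f \<alpha>" and nonneg: "\<And>\<alpha>. f \<alpha> \<ge> 0"
  shows "(\<Prod>\<alpha>\<in>P. f (w \<alpha>)) = (\<Prod>\<alpha>\<in>P. f \<alpha>)"
proof -
  note P = positive_system_choice[OF rs]
  have sq: "(\<Prod>\<alpha>\<in>\<Phi>. g \<alpha>) = (\<Prod>\<alpha>\<in>P. g \<alpha>)\<^sup>2" if "\<And>\<alpha>. g (- \<alpha>) = g \<alpha>" for g :: "'a \<Rightarrow> real"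
  proof -
    have "(\<Prod>\<alpha>\<in>\<Phi>. g \<alpha>) = (\<Prod>\<alpha>\<in>P. g \<alpha>) * (\<Prod>\<alpha>\<in>uminus ` P. g \<alpha>)"
      using P by (subst P(4)) (auto intro!: prod.union_disjoint)
    also have "(\<Prod>\<alpha>\<in>uminus ` P. g \<alpha>) = (\<Prod>\<alpha>\<in>P. g \<alpha>)"
      by (subst prod.reindex) (auto simp: inj_on_def that)
    finally show ?thesis by (simp add: power2_eq_square)
  qed
  have "(\<Prod>\<alpha>\<in>P. f (w \<alpha>))\<^sup>2 = (\<Prod>\<alpha>\<in>\<Phi>. f (w \<alpha>))"
    by (rule sq[symmetric]) (simp add: linear_neg[OF weyl_group_linear[OF w]] even)
  also have "\<dots> = (\<Prod>\<alpha>\<in>\<Phi>. f \<alpha>)"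
    by (rule prod.reindex_bij_betw[OF bij_betw_weyl_group_roots[OF rs(1) w]])
  also have "\<dots> = (\<Prod>\<alpha>\<in>P. f \<alpha>)\<^sup>2" by (rule sq) (rule even)
  finally show ?thesis
    by (simp add: power2_eq_iff_nonneg prod_nonneg nonneg)
qed

section \<open>The complexified space\<close>

text \<open>The complexification of the space is modelled by pairs, with \<open>(x, y)\<close> standing for \<open>x + \<i>y\<close>.
This is multiplication by a complex scalar.\<close>

definition cscale :: "complex \<Rightarrow> 'a::real_vector \<times> 'a \<Rightarrow> 'a \<times> 'a" where
  "cscale z X = (Re z *\<^sub>R fst X - Im z *\<^sub>R snd X, Im z *\<^sub>R fst X + Re z *\<^sub>R snd X)"

lemma cscale_add_left: "cscale (z + w) X = cscale z X + cscale w X"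
  by (simp add: cscale_def algebra_simps)

lemma cscale_cscale: "cscale z (cscale w X) = cscale (z * w) X"
  by (simp add: cscale_def algebra_simps)

lemma cscale_of_real: "cscale (of_real r) X = r *\<^sub>R X"
  by (cases X) (simp add: cscale_def)

lemma cscale_0: "cscale 0 X = 0"
  by (simp add: cscale_def zero_prod_def)

lemma cscale_scaleR: "cscale z (r *\<^sub>R X) = r *\<^sub>R cscale z X"
  by (simp add: cscale_def algebra_simps)

lemma norm_cscale:
  fixes X :: "'a::real_inner \<times> 'a"
  shows "norm (cscale z X) = cmod z * norm X"
proof -
  have "(norm (cscale z X))\<^sup>2 = (cmod z)\<^sup>2 * (norm X)\<^sup>2"
    unfolding power2_norm_eq_inner
    by (simp add: cscale_def inner_prod_def inner_complex_def algebra_simps inner_commute power2_eq_square)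
  then show ?thesis
    by (metis norm_ge_zero power2_eq_imp_eq power_mult_distrib mult_nonneg_nonneg)
qed

lemma bounded_linear_cscale_left: "bounded_linear (\<lambda>z. cscale z (X :: 'a::real_inner \<times> 'a))"
  by (rule bounded_linear_intro[where K = "norm X"])
    (auto simp: cscale_add_left norm_cscale, simp add: cscale_def algebra_simps)

lemma continuous_on_cscale [continuous_intros]:
  fixes g :: "_ \<Rightarrow> 'a::real_inner \<times> 'a"
  shows "continuous_on S f \<Longrightarrow> continuous_on S g \<Longrightarrow> continuous_on S (\<lambda>x. cscale (f x) (g x))"
  unfolding cscale_def by (intro continuous_intros)

text \<open>The complex-linear extension of the functional \<open>x \<mapsto> \<alpha> \<bullet> x\<close>.\<close>

definition cpair :: "'a::real_inner \<Rightarrow> 'a \<times> 'a \<Rightarrow> complex" where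
  "cpair \<alpha> X = Complex (\<alpha> \<bullet> fst X) (\<alpha> \<bullet> snd X)"

lemma cpair_add_left: "cpair (\<alpha> + \<beta>) X = cpair \<alpha> X + cpair \<beta> X"
  by (simp add: cpair_def complex_eq_iff inner_left_distrib)

lemma cpair_scaleR_left: "cpair (r *\<^sub>R \<alpha>) X = r *\<^sub>R cpair \<alpha> X"
  by (simp add: cpair_def complex_eq_iff)

lemma cpair_minus_left: "cpair (- \<alpha>) X = - cpair \<alpha> X"
  by (simp add: cpair_def complex_eq_iff)

lemma cpair_diff_left: "cpair (\<alpha> - \<beta>) X = cpair \<alpha> X - cpair \<beta> X"
  by (simp add: cpair_def complex_eq_iff algebra_simps)

lemma cpair_0_left [simp]: "cpair 0 X = 0"
  by (simp add: cpair_def complex_eq_iff)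

lemma cpair_sum_left: "cpair (\<Sum>i\<in>I. f i) X = (\<Sum>i\<in>I. cpair (f i) X)"
  by (induction I rule: infinite_finite_induct) (auto simp: cpair_add_left)

lemma cpair_add_right: "cpair \<alpha> (X + Y) = cpair \<alpha> X + cpair \<alpha> Y"
  by (simp add: cpair_def complex_eq_iff inner_right_distrib)

lemma cpair_diff_right: "cpair \<alpha> (X - Y) = cpair \<alpha> X - cpair \<alpha> Y"
  by (simp add: cpair_def complex_eq_iff algebra_simps)

lemma cpair_scaleR_right: "cpair \<alpha> (r *\<^sub>R X) = r *\<^sub>R cpair \<alpha> X"
  by (simp add: cpair_def complex_eq_iff)

lemma cpair_cscale: "cpair \<alpha> (cscale z X) = z * cpair \<alpha> X"
  by (simp add: cpair_def cscale_def complex_eq_iff algebra_simps)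

lemma cpair_real: "cpair \<alpha> (x, 0) = of_real (\<alpha> \<bullet> x)"
  by (simp add: cpair_def complex_eq_iff)

lemma norm_cpair_le: "cmod (cpair \<alpha> X) \<le> norm \<alpha> * norm X"
proof -
  have "\<bar>\<alpha> \<bullet> fst X\<bar> \<le> norm \<alpha> * norm (fst X)" "\<bar>\<alpha> \<bullet> snd X\<bar> \<le> norm \<alpha> * norm (snd X)"
    by (rule Cauchy_Schwarz_ineq2)+
  then have "(\<alpha> \<bullet> fst X)\<^sup>2 \<le> (norm \<alpha> * norm (fst X))\<^sup>2" "(\<alpha> \<bullet> snd X)\<^sup>2 \<le> (norm \<alpha> * norm (snd X))\<^sup>2"
    by (metis abs_ge_zero power2_abs power_mono)+
  then have "(\<alpha> \<bullet> fst X)\<^sup>2 + (\<alpha> \<bullet> snd X)\<^sup>2 \<le> (norm \<alpha>)\<^sup>2 * ((norm (fst X))\<^sup>2 + (norm (snd X))\<^sup>2)"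
    by (simp add: power_mult_distrib distrib_left)
  then show ?thesis
    by (simp add: cpair_def cmod_def norm_prod_def real_sqrt_le_iff real_le_lsqrt power_mult_distrib)
qed

lemma bounded_linear_cpair: "bounded_linear (cpair \<alpha>)"
  by (rule bounded_linear_intro[where K = "norm \<alpha>"])
    (use norm_cpair_le in \<open>auto simp: cpair_add_right cpair_scaleR_right mult.commute\<close>)

lemma continuous_on_cpair [continuous_intros]:
  "continuous_on S g \<Longrightarrow> continuous_on S (\<lambda>x. cpair \<alpha> (g x))"
  using bounded_linear.continuous_on[OF bounded_linear_cpair] .

section \<open>Holomorphic functions on the complexification\<close>

text \<open>Real Frechet differentiability with a complex-linear derivative. Unlike holomorphy in each variable
separately, this notion contains continuity and passes at once to complex lines and to real slices.\<close>

definition holo :: "('a::euclidean_space \<times> 'a \<Rightarrow> complex) \<Rightarrow> bool" where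
  "holo E \<longleftrightarrow> (\<forall>X. \<exists>E'. (E has_derivative E') (at X) \<and> (\<forall>z Y. E' (cscale z Y) = z * E' Y))"

definition cderiv :: "'a \<times> 'a \<Rightarrow> ('a::euclidean_space \<times> 'a \<Rightarrow> complex) \<Rightarrow> 'a \<times> 'a \<Rightarrow> complex" where
  "cderiv Y E X = frechet_derivative E (at X) Y"

lemma holo_has_derivative: "holo E \<Longrightarrow> (E has_derivative (\<lambda>Y. cderiv Y E X)) (at X)"
  unfolding holo_def cderiv_def by (metis frechet_derivative_at)

lemma cderiv_unique: "(E has_derivative E') (at X) \<Longrightarrow> cderiv Y E X = E' Y"
  unfolding cderiv_def by (metis frechet_derivative_at)

lemma cderiv_cscale: "holo E \<Longrightarrow> cderiv (cscale z Y) E X = z * cderiv Y E X"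
  unfolding holo_def using cderiv_unique by metis

lemma holoI:
  assumes "\<And>X. (E has_derivative (\<lambda>Y. E' Y X)) (at X)" "\<And>z X Y. E' (cscale z Y) X = z * E' Y X"
  shows "holo E" "cderiv Y E X = E' Y X"
  unfolding holo_def using assms cderiv_unique[OF assms(1)] by blast+

lemma bounded_linear_cderiv: "holo E \<Longrightarrow> bounded_linear (\<lambda>Y. cderiv Y E X)"
  using holo_has_derivative has_derivative_bounded_linear by blast

lemma cderiv_scaleR: "holo E \<Longrightarrow> cderiv (r *\<^sub>R Y) E X = r *\<^sub>R cderiv Y E X"
  by (rule linear_scale[OF bounded_linear.linear[OF bounded_linear_cderiv]])

lemma holo_continuous: "holo E \<Longrightarrow> continuous_on S E"
  by (rule continuous_at_imp_continuous_on) (blast intro: has_derivative_continuous holo_has_derivative)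

lemma holo_continuous_compose:
  "holo E \<Longrightarrow> continuous_on S g \<Longrightarrow> continuous_on S (\<lambda>x. E (g x))"
  using continuous_on_compose2[OF holo_continuous[of E UNIV]] by blast

lemma holo_line_derivative:
  assumes "holo E"
  shows "((\<lambda>z. E (X + cscale z Y)) has_field_derivative cderiv Y E (X + cscale z Y)) (at z)"
proof -
  have "((\<lambda>z. X + cscale z Y) has_derivative (\<lambda>h. cscale h Y)) (at z)"
    by (auto intro!: derivative_eq_intros bounded_linear.has_derivative[OF bounded_linear_cscale_left])
  then have "((\<lambda>z. E (X + cscale z Y)) has_derivative (\<lambda>h. cderiv (cscale h Y) E (X + cscale z Y))) (at z)"
    using has_derivative_compose[OF _ holo_has_derivative[OF assms]] by blast
  moreover have "(\<lambda>h. cderiv (cscale h Y) E (X + cscale z Y)) = (*) (cderiv Y E (X + cscale z Y))"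
    by (simp add: fun_eq_iff cderiv_cscale[OF assms] mult.commute)
  ultimately show ?thesis
    by (simp add: has_field_derivative_def)
qed

lemma holo_line_holomorphic: "holo E \<Longrightarrow> (\<lambda>z. E (X + cscale z Y)) holomorphic_on S"
  unfolding holomorphic_on_def field_differentiable_def
  using holo_line_derivative has_field_derivative_at_within by blast

text \<open>Cauchy's formula on the unit circle of a complex line expresses a directional derivative by values
of the function. Continuity, holomorphy and bounds for the derivative are all read off from it.\<close>

lemma cderiv_eq_circle_integral:
  assumes "holo E"
  shows "cderiv Y E X =
    integral {0..1} (\<lambda>t. E (X + cscale (cis (2 * pi * t)) Y) / cis (2 * pi * t))"
proof -
  let ?f = "\<lambda>z. E (X + cscale z Y)"
  have exp: "exp (2 * complex_of_real pi * \<i> * complex_of_real t) = cis (2 * pi * t)" for t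
    by (simp add: cis_conv_exp mult_ac)
  have path: "circlepath 0 1 t = cis (2 * pi * t)"
    "vector_derivative (circlepath 0 1) (at t) = 2 * of_real pi * \<i> * cis (2 * pi * t)" for t
    by (simp_all only: vector_derivative_circlepath exp) (simp_all add: circlepath exp)
  have "?f holomorphic_on UNIV" by (rule holo_line_holomorphic[OF assms])
  then have "(?f has_field_derivative 1 / (2 * of_real pi * \<i>) *
      contour_integral (circlepath 0 1) (\<lambda>u. ?f u / (u - 0)\<^sup>2)) (at 0)"
    by (intro Cauchy_derivative_integral_circlepath)
      (auto intro: holomorphic_on_imp_continuous_on holomorphic_on_subset)
  moreover have "(?f has_field_derivative cderiv Y E X) (at 0)"
    using holo_line_derivative[OF assms, of X Y 0] by (simp add: cscale_0)
  ultimately have "cderiv Y E X =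
      1 / (2 * of_real pi * \<i>) * contour_integral (circlepath 0 1) (\<lambda>u. ?f u / u\<^sup>2)"
    using DERIV_unique by fastforce
  also have "\<dots> = integral {0..1} (\<lambda>t. 1 / (2 * of_real pi * \<i>) *
      (?f (circlepath 0 1 t) / (circlepath 0 1 t)\<^sup>2 * vector_derivative (circlepath 0 1) (at t)))"
    by (simp only: contour_integral_integral integral_mult_right)
  also have "\<dots> = integral {0..1} (\<lambda>t. ?f (cis (2 * pi * t)) / cis (2 * pi * t))"
    by (intro integral_cong)
      (simp add: path power2_eq_square)
  finally show ?thesis .
qed

lemma continuous_on_cderiv:
  assumes "holo E"
  shows "continuous_on UNIV (\<lambda>(Y, X). cderiv Y E X)"
proof -
  have "continuous_on UNIV (\<lambda>p :: ('a \<times> 'a) \<times> ('a \<times> 'a). integral (cbox 0 1)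
      (\<lambda>t. E (snd p + cscale (cis (2 * pi * t)) (fst p)) / cis (2 * pi * t)))"
    by (rule integral_continuous_on_param)
      (auto simp: split_beta intro!: continuous_intros holo_continuous_compose[OF assms]
        continuous_on_cis)
  then show ?thesis
    by (simp add: cderiv_eq_circle_integral[OF assms] split_beta)
qed

lemma continuous_on_cderiv_compose:
  assumes "holo E" "continuous_on S f" "continuous_on S g"
  shows "continuous_on S (\<lambda>x. cderiv (f x) E (g x))"
  using continuous_on_compose2[OF continuous_on_cderiv[OF assms(1)] continuous_on_Pair[OF assms(2,3)]]
  by simp

lemma norm_cderiv_le:
  assumes "holo E" "\<And>z. cmod z = 1 \<Longrightarrow> cmod (E (X + cscale z Y)) \<le> M"
  shows "cmod (cderiv Y E X) \<le> M"
proof -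
  have "cmod (integral {0..1} (\<lambda>t. E (X + cscale (cis (2 * pi * t)) Y) / cis (2 * pi * t))) \<le> M * (1 - 0)"
    by (rule integral_bound)
      (use assms in \<open>auto simp: norm_divide intro!: continuous_intros
        holo_continuous_compose[OF assms(1)] continuous_on_cis\<close>)
  then show ?thesis by (simp add: cderiv_eq_circle_integral[OF assms(1)])
qed

text \<open>Differentiation under the integral sign; a complex-linear derivative stays complex-linear after
integration.\<close>

lemma holo_integral:
  fixes G :: "real \<Rightarrow> 'a::euclidean_space \<times> 'a \<Rightarrow> complex"
  assumes holo: "\<And>t. t \<in> {0..1} \<Longrightarrow> holo (G t)"
    and contG: "continuous_on (UNIV \<times> {0..1}) (\<lambda>(X, t). G t X)"
    and cont: "\<And>Y. continuous_on (UNIV \<times> {0..1}) (\<lambda>(X, t). cderiv Y (G t) X)"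
  shows "holo (\<lambda>X. integral {0..1} (\<lambda>t. G t X))"
proof (rule holoI(1))
  fix X Y :: "'a \<times> 'a" and z :: complex
  define D where "D X t = Blinfun (\<lambda>Y. cderiv Y (G t) X)" for X t
  have D: "blinfun_apply (D X t) Y = cderiv Y (G t) X" if "t \<in> {0..1}" for X Y t
    unfolding D_def using bounded_linear_cderiv[OF holo[OF that]]
    by (simp add: bounded_linear_Blinfun_apply)
  have contD: "continuous_on (UNIV \<times> {0..1}) (\<lambda>(X, t). D X t)"
  proof (rule continuous_on_blinfun_componentwise)
    fix Y :: "'a \<times> 'a"
    have "continuous_on (UNIV \<times> {0..1}) (\<lambda>p. blinfun_apply (D (fst p) (snd p)) Y) \<longleftrightarrow>
        continuous_on (UNIV \<times> {0..1}) (\<lambda>p. cderiv Y (G (snd p)) (fst p))"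
      by (rule continuous_on_cong) (auto simp: D)
    then show "continuous_on (UNIV \<times> {0..1}) (\<lambda>p. blinfun_apply (case p of (X, t) \<Rightarrow> D X t) Y)"
      using cont[of Y] by (simp add: split_beta)
  qed
  have intD: "D X integrable_on {0..1}"
    by (intro integrable_continuous_interval continuous_on_compose2[OF contD, of _ "\<lambda>t. (X, t)",
          simplified]) (auto intro!: continuous_intros)
  have app: "integral {0..1} (D X) Y = integral {0..1} (\<lambda>t. cderiv Y (G t) X)" for Y
  proof -
    have "integral {0..1} ((\<lambda>b. blinfun_apply b Y) \<circ> D X) = integral {0..1} (D X) Y"
      using integral_linear[OF intD blinfun.bounded_linear_left] .
    moreover have "integral {0..1} ((\<lambda>b. blinfun_apply b Y) \<circ> D X)
        = integral {0..1} (\<lambda>t. cderiv Y (G t) X)"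
      by (rule integral_cong) (simp add: D)
    ultimately show ?thesis by simp
  qed
  have "((\<lambda>X. integral (cbox 0 1) (\<lambda>t. G t X)) has_derivative integral (cbox 0 1) (D X)) (at X within UNIV)"
  proof (rule leibniz_rule)
    fix X t assume t: "t \<in> cbox 0 (1::real)"
    show "((\<lambda>X. G t X) has_derivative blinfun_apply (D X t)) (at X)"
    proof (rule has_derivative_eq_rhs[OF holo_has_derivative[OF holo]])
      show "(\<lambda>Y. cderiv Y (G t) X) = blinfun_apply (D X t)"
        by (rule ext) (rule D[symmetric], use t in simp)
    qed (use t in simp)
  next
    fix X :: "'a \<times> 'a"
    have "continuous_on {0..1} (\<lambda>t. (X, t))" by (intro continuous_intros)
    then have "continuous_on {0..1} (\<lambda>t. G t X)"
      using continuous_on_compose2[OF contG] by fastforce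
    then show "(\<lambda>t. G t X) integrable_on cbox 0 (1::real)"
      using integrable_continuous_interval by simp
  qed (use contD in auto)
  then show "((\<lambda>X. integral {0..1} (\<lambda>t. G t X)) has_derivative
      (\<lambda>Y. integral {0..1} (\<lambda>t. cderiv Y (G t) X))) (at X)"
    by (simp add: app[symmetric])
  have "integral {0..1} (\<lambda>t. cderiv (cscale z Y) (G t) X) = integral {0..1} (\<lambda>t. z * cderiv Y (G t) X)"
    by (rule integral_cong) (simp add: cderiv_cscale holo)
  then show "integral {0..1} (\<lambda>t. cderiv (cscale z Y) (G t) X) = z * integral {0..1} (\<lambda>t. cderiv Y (G t) X)"
    by simp
qed

lemma holo_affine:
  fixes L :: "'a::euclidean_space \<times> 'a \<Rightarrow> 'a \<times> 'a"
  assumes "holo E" "bounded_linear L" "\<And>z Y. L (cscale z Y) = cscale z (L Y)"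
  shows "holo (\<lambda>X. c * E (L X + B))" "cderiv Y (\<lambda>X. c * E (L X + B)) X = c * cderiv (L Y) E (L X + B)"
proof -
  have "((\<lambda>X. c * E (L X + B)) has_derivative (\<lambda>Y. c * cderiv (L Y) E (L X + B))) (at X)" for X
    by (intro has_derivative_mult_right has_derivative_compose[OF _ holo_has_derivative[OF assms(1)]])
      (auto intro!: derivative_eq_intros bounded_linear.has_derivative[OF assms(2)])
  then show "holo (\<lambda>X. c * E (L X + B))" "cderiv Y (\<lambda>X. c * E (L X + B)) X = c * cderiv (L Y) E (L X + B)"
    by (rule holoI; simp add: assms(3) cderiv_cscale[OF assms(1)])+
qed

lemma holo_0: "holo (\<lambda>X. 0)"
  by (rule holoI(1)[where E' = "\<lambda>Y X. 0"]) auto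

lemma holo_add:
  assumes "holo E" "holo F"
  shows "holo (\<lambda>X. E X + F X)"
  by (rule holoI(1)[where E' = "\<lambda>Y X. cderiv Y E X + cderiv Y F X"])
    (auto intro!: has_derivative_add holo_has_derivative assms
      simp: cderiv_cscale assms distrib_left)

lemma holo_sum: "(\<And>i. i \<in> I \<Longrightarrow> holo (E i)) \<Longrightarrow> holo (\<lambda>X. \<Sum>i\<in>I. E i X)"
  by (induction I rule: infinite_finite_induct) (auto intro: holo_0 holo_add)

lemma holo_exponential: "holo (\<lambda>X. c * exp (\<i> * cpair a X))"
proof (rule holoI(1)[where E' = "\<lambda>Y X. c * (exp (\<i> * cpair a X) * (\<i> * cpair a Y))"])
  fix X :: "'a \<times> 'a"
  have "((\<lambda>X. \<i> * cpair a X) has_derivative (\<lambda>Y. \<i> * cpair a Y)) (at X)"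
    by (intro has_derivative_mult_right bounded_linear_imp_has_derivative bounded_linear_cpair)
  moreover have "(exp has_derivative (*) (exp (\<i> * cpair a X))) (at (\<i> * cpair a X))"
    using DERIV_exp by (simp add: has_field_derivative_def)
  ultimately have "((\<lambda>X. exp (\<i> * cpair a X)) has_derivative
      (\<lambda>Y. exp (\<i> * cpair a X) * (\<i> * cpair a Y))) (at X)"
    using has_derivative_compose by blast
  then show "((\<lambda>X. c * exp (\<i> * cpair a X)) has_derivative
      (\<lambda>Y. c * (exp (\<i> * cpair a X) * (\<i> * cpair a Y)))) (at X)"
    by (rule has_derivative_mult_right)
qed (simp add: cpair_cscale)

lemma holo_cderiv:
  assumes "holo E"
  shows "holo (cderiv Y E)"
proof -
  let ?G = "\<lambda>t X. (1 / cis (2 * pi * t)) * E (X + cscale (cis (2 * pi * t)) Y)"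
  have "holo (?G t)" "cderiv Z (?G t) X = (1 / cis (2 * pi * t)) *
      cderiv Z E (X + cscale (cis (2 * pi * t)) Y)" for Z X t
    by (rule holo_affine[where L = "\<lambda>X. X", OF assms bounded_linear_ident refl])+
  then have "holo (\<lambda>X. integral {0..1} (\<lambda>t. ?G t X))"
    by (intro holo_integral)
      (auto simp: split_beta intro!: continuous_intros holo_continuous_compose[OF assms]
        continuous_on_cderiv_compose[OF assms] continuous_on_cis)
  moreover have "cderiv Y E = (\<lambda>X. integral {0..1} (\<lambda>t. ?G t X))"
    by (simp add: fun_eq_iff cderiv_eq_circle_integral[OF assms])
  ultimately show ?thesis by simp
qed

text \<open>Hadamard's lemma: join \<open>X\<close> to its projection onto the hyperplane \<open>\<alpha> = 0\<close>, where \<open>f\<close> vanishes, and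
integrate the derivative of \<open>f\<close> along this segment. The velocity is proportional to \<open>\<alpha>(X)\<close>, which
comes out of the integral.\<close>

lemma holo_divide_root:
  fixes f :: "'a::euclidean_space \<times> 'a \<Rightarrow> complex"
  assumes f: "holo f" and "\<alpha> \<noteq> 0" and vanish: "\<And>X. cpair \<alpha> X = 0 \<Longrightarrow> f X = 0"
  obtains q where "holo q" "\<And>X. f X = cpair \<alpha> X * q X"
proof
  \<comment> \<open>\<open>L 1\<close> is the identity and \<open>L 0\<close> is the projection onto the hyperplane along \<open>A\<close>\<close>
  define A where "A = ((1 / (\<alpha> \<bullet> \<alpha>)) *\<^sub>R \<alpha>, 0 :: 'a)"
  have A: "cpair \<alpha> A = 1" using assms(2) by (simp add: A_def cpair_real)
  define L where "L t X = X - (1 - t) *\<^sub>R cscale (cpair \<alpha> X) A" for t X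
  have blL: "bounded_linear (L t)" for t
  proof -
    have "bounded_linear (\<lambda>X. cscale (cpair \<alpha> X) A)"
      by (rule bounded_linear_compose[OF bounded_linear_cscale_left bounded_linear_cpair])
    then have "bounded_linear (\<lambda>X. (1 - t) *\<^sub>R cscale (cpair \<alpha> X) A)"
      by (rule bounded_linear_compose[OF bounded_linear_scaleR_right])
    then show ?thesis
      unfolding L_def by (intro bounded_linear_sub bounded_linear_ident)
  qed
  have Lz: "L t (cscale z Y) = cscale z (L t Y)" for t z Y
  proof -
    have "cscale z (Y - B) = cscale z Y - cscale z B" for B :: "'a \<times> 'a"
      by (simp add: cscale_def algebra_simps)
    then show ?thesis
      by (simp add: L_def cpair_cscale cscale_cscale cscale_scaleR)
  qed
  define q where "q X = integral {0..1} (\<lambda>t. cderiv A f (L t X))" for X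
  have g: "holo (cderiv A f)" by (rule holo_cderiv[OF f])
  have "holo (\<lambda>X. cderiv A f (L t X))" "cderiv Y (\<lambda>X. cderiv A f (L t X)) X = cderiv (L t Y) (cderiv A f) (L t X)"
    for t X Y
    using holo_affine[OF g blL Lz, where c = 1 and B = 0] by simp_all
  then show "holo q"
    unfolding q_def
    by (intro holo_integral)
      (auto simp: split_beta L_def intro!: continuous_intros holo_continuous_compose[OF g]
        continuous_on_cderiv_compose[OF g])
  show "f X = cpair \<alpha> X * q X" for X
  proof -
    let ?V = "cscale (cpair \<alpha> X) A"
    have "((\<lambda>t. cderiv ?V f (L t X)) has_integral f (L 1 X) - f (L 0 X)) {0..1}"
    proof (rule fundamental_theorem_of_calculus)
      fix t :: real
      have "((\<lambda>t. L t X) has_derivative (\<lambda>h. h *\<^sub>R ?V)) (at t within {0..1})"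
        unfolding L_def by (auto intro!: derivative_eq_intros simp: scaleR_left_diff_distrib)
      then have "((\<lambda>t. f (L t X)) has_derivative (\<lambda>h. cderiv (h *\<^sub>R ?V) f (L t X))) (at t within {0..1})"
        using has_derivative_compose[OF _ holo_has_derivative[OF f]] by blast
      then show "((\<lambda>t. f (L t X)) has_vector_derivative cderiv ?V f (L t X)) (at t within {0..1})"
        by (simp add: has_vector_derivative_def cderiv_scaleR[OF f])
    qed simp
    moreover have "f (L 0 X) = 0"
      by (rule vanish) (simp add: L_def cpair_diff_right cpair_cscale A)
    moreover have "L 1 X = X" by (simp add: L_def)
    ultimately have "f X = integral {0..1} (\<lambda>t. cpair \<alpha> X * cderiv A f (L t X))"
      by (simp add: cderiv_cscale[OF f] has_integral_iff)
    then show ?thesis by (simp add: q_def)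
  qed
qed

section \<open>Division by the roots\<close>

text \<open>Finitely many hyperplanes do not cover a neighbourhood. The vectors \<open>u \<in> U\<close> are treated one after the
other: if the combination found so far is orthogonal to the next one, a small change of a single
coefficient repairs this, and all but finitely many changes keep the conditions already achieved.
Restricting the perturbation to combinations of \<open>A\<close> keeps it inside a hyperplane in one application,
and in the other it makes the size of its pairings controllable by those of \<open>A\<close>.\<close>

lemma generic_combination:
  fixes A U :: "'a::euclidean_space set"
  assumes "finite A" "finite U" "\<And>u. u \<in> U \<Longrightarrow> \<exists>a\<in>A. a \<bullet> u \<noteq> 0" "\<delta> > 0"
  shows "\<exists>c. (\<forall>a\<in>A. 0 \<le> c a \<and> c a < \<delta>) \<and> (\<forall>u\<in>U. (y0 + (\<Sum>a\<in>A. c a *\<^sub>R a)) \<bullet> u \<noteq> 0)"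
  using assms(2,3)
proof (induction U rule: finite_induct)
  case empty
  then show ?case using \<open>\<delta> > 0\<close> by (intro exI[of _ "\<lambda>_. 0"]) auto
next
  case (insert u U)
  have "\<exists>c. (\<forall>a\<in>A. 0 \<le> c a \<and> c a < \<delta>) \<and> (\<forall>u\<in>U. (y0 + (\<Sum>a\<in>A. c a *\<^sub>R a)) \<bullet> u \<noteq> 0)"
    by (rule insert.IH) (use insert.prems in blast)
  then obtain c where c: "\<forall>a\<in>A. 0 \<le> c a \<and> c a < \<delta>" "\<forall>u\<in>U. (y0 + (\<Sum>a\<in>A. c a *\<^sub>R a)) \<bullet> u \<noteq> 0"
    by blast
  obtain b where b: "b \<in> A" "b \<bullet> u \<noteq> 0" using insert.prems by auto
  define y where "y = y0 + (\<Sum>a\<in>A. c a *\<^sub>R a)"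
  define bad where "bad = (\<lambda>v. - (y \<bullet> v) / (b \<bullet> v)) ` insert u U"
  have "infinite {0<..<\<delta> - c b}" using c(1) b by auto
  moreover have "finite bad" using insert.hyps by (simp add: bad_def)
  ultimately have "{0<..<\<delta> - c b} - bad \<noteq> {}"
    using Diff_infinite_finite infinite_imp_nonempty by blast
  then obtain s where s: "s \<in> {0<..<\<delta> - c b}" "s \<notin> bad"
    by blast
  have "(\<Sum>a\<in>A. (c(b := c b + s)) a *\<^sub>R a) = (\<Sum>a\<in>A. c a *\<^sub>R a + (if a = b then s *\<^sub>R b else 0))"
    by (rule sum.cong) (auto simp: algebra_simps)
  also have "\<dots> = (\<Sum>a\<in>A. c a *\<^sub>R a) + s *\<^sub>R b"
    using b assms(1) by (simp add: sum.distrib)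
  finally have sum: "y0 + (\<Sum>a\<in>A. (c(b := c b + s)) a *\<^sub>R a) = y + s *\<^sub>R b"
    by (simp add: y_def add.assoc)
  have "(y + s *\<^sub>R b) \<bullet> v \<noteq> 0" if "v \<in> insert u U" for v
  proof (cases "b \<bullet> v = 0")
    case True
    then show ?thesis using that b c(2) by (auto simp: inner_left_distrib y_def)
  next
    case False
    have "s \<noteq> - (y \<bullet> v) / (b \<bullet> v)" using s(2) that unfolding bad_def by blast
    then show ?thesis using False by (auto simp: inner_left_distrib field_simps)
  qed
  then show ?case
    using sum c(1) s(1) b by (intro exI[of _ "c(b := c b + s)"]) auto
qed

text \<open>Regular points are dense: from any point one moves off all the hyperplanes at once by following a
real direction \<open>y\<close> that lies on none of them.\<close>

lemma eventually_regular_line: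
  fixes y :: "'a::euclidean_space"
  assumes "finite P" "\<And>\<alpha>. \<alpha> \<in> P \<Longrightarrow> \<alpha> \<bullet> y \<noteq> 0"
  shows "\<forall>\<^sub>F t in at (0::real). \<forall>\<alpha>\<in>P. cpair \<alpha> (X + t *\<^sub>R (y, 0)) \<noteq> 0"
proof -
  let ?S = "(\<lambda>\<alpha>. - Re (cpair \<alpha> X) / (\<alpha> \<bullet> y)) ` P"
  have "\<forall>\<^sub>F t in at (0::real). t \<notin> ?S"
    using islimpt_iff_eventually islimpt_finite assms(1) by blast
  then show ?thesis
  proof (rule eventually_mono, intro ballI)
    fix t \<alpha> assume *: "t \<notin> ?S" "\<alpha> \<in> P"
    then have "t \<noteq> - Re (cpair \<alpha> X) / (\<alpha> \<bullet> y)" by blast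
    then have "Re (cpair \<alpha> X) + t * (\<alpha> \<bullet> y) \<noteq> 0"
      using assms(2)[OF *(2)] by (auto simp: field_simps)
    then show "cpair \<alpha> (X + t *\<^sub>R (y, 0)) \<noteq> 0"
      by (auto simp: cpair_def complex_eq_iff inner_add_right)
  qed
qed

lemma holo_tendsto_line:
  assumes "holo E"
  shows "((\<lambda>t. E (X + t *\<^sub>R Y)) \<longlongrightarrow> E X) (at (0::real))"
proof -
  have "continuous_on UNIV (\<lambda>t::real. E (X + t *\<^sub>R Y))"
    by (intro holo_continuous_compose[OF assms] continuous_intros)
  then have "isCont (\<lambda>t::real. E (X + t *\<^sub>R Y)) 0"
    by (simp add: continuous_on_eq_continuous_at)
  then show ?thesis by (simp add: isCont_def)
qed

text \<open>Divide by one root after the other. After division by some roots the quotient is known to vanish on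
the next hyperplane only away from the earlier ones. Since the hyperplanes are distinct, such points
are dense in it, and continuity gives the rest.\<close>

lemma holo_divide_roots:
  fixes f :: "'a::euclidean_space \<times> 'a \<Rightarrow> complex"
  assumes "finite P" "holo f" "0 \<notin> P"
    and "\<And>\<alpha> \<beta> c. \<alpha> \<in> P \<Longrightarrow> \<beta> \<in> P \<Longrightarrow> \<alpha> \<noteq> \<beta> \<Longrightarrow> \<beta> \<noteq> c *\<^sub>R \<alpha>"
    and "\<And>\<alpha> X. \<alpha> \<in> P \<Longrightarrow> cpair \<alpha> X = 0 \<Longrightarrow> f X = 0"
  shows "\<exists>q. holo q \<and> (\<forall>X. f X = (\<Prod>\<alpha>\<in>P. cpair \<alpha> X) * q X)"
  using assms(1,3-)
proof (induction P rule: finite_induct)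
  case empty
  then show ?case using assms(2) by auto
next
  case (insert \<alpha> P)
  have "\<exists>q. holo q \<and> (\<forall>X. f X = (\<Prod>\<alpha>\<in>P. cpair \<alpha> X) * q X)"
  proof (rule insert.IH)
    show "0 \<notin> P" using insert.prems(1) by simp
    show "\<beta> \<noteq> c *\<^sub>R \<gamma>" if "\<gamma> \<in> P" "\<beta> \<in> P" "\<gamma> \<noteq> \<beta>" for \<gamma> \<beta> c
      by (rule insert.prems(2)) (use that in simp_all)
    show "f X = 0" if "\<beta> \<in> P" "cpair \<beta> X = 0" for \<beta> X
      by (rule insert.prems(3)) (use that in auto)
  qed
  then obtain q where q: "holo q" "\<And>X. f X = (\<Prod>\<alpha>\<in>P. cpair \<alpha> X) * q X" by blast
  \<comment> \<open>projections of the earlier roots to the hyperplane of \<open>\<alpha>\<close>: their combinations move inside it\<close>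
  define proj where "proj \<beta> = \<beta> - ((\<alpha> \<bullet> \<beta>) / (\<alpha> \<bullet> \<alpha>)) *\<^sub>R \<alpha>" for \<beta>
  have a: "\<alpha> \<noteq> 0" using insert.prems by auto
  have orth: "\<alpha> \<bullet> proj \<beta> = 0" for \<beta> using a by (simp add: proj_def inner_diff_right)
  have ne: "proj \<beta> \<noteq> 0" if "\<beta> \<in> P" for \<beta>
  proof
    assume "proj \<beta> = 0"
    then have "\<beta> = ((\<alpha> \<bullet> \<beta>) / (\<alpha> \<bullet> \<alpha>)) *\<^sub>R \<alpha>" by (simp add: proj_def)
    moreover have "\<beta> \<noteq> ((\<alpha> \<bullet> \<beta>) / (\<alpha> \<bullet> \<alpha>)) *\<^sub>R \<alpha>"
      by (rule insert.prems(2)) (use that insert.hyps in auto)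
    ultimately show False by contradiction
  qed
  have "\<exists>c. (\<forall>a\<in>proj ` P. 0 \<le> c a \<and> c a < 1) \<and> (\<forall>u\<in>P. (0 + (\<Sum>a\<in>proj ` P. c a *\<^sub>R a)) \<bullet> u \<noteq> 0)"
  proof (rule generic_combination)
    fix \<beta> assume b: "\<beta> \<in> P"
    have "proj \<beta> \<bullet> proj \<beta> = proj \<beta> \<bullet> \<beta>"
      using orth[of \<beta>] by (simp add: proj_def[of \<beta>] inner_diff_right inner_commute)
    then show "\<exists>a\<in>proj ` P. a \<bullet> \<beta> \<noteq> 0" using ne[OF b] b by force
  qed (use insert.hyps in auto)
  then obtain c where c: "\<And>u. u \<in> P \<Longrightarrow> (\<Sum>a\<in>proj ` P. c a *\<^sub>R a) \<bullet> u \<noteq> 0"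
    unfolding add_0_left by blast
  define y where "y = (\<Sum>a\<in>proj ` P. c a *\<^sub>R a)"
  have y: "\<alpha> \<bullet> y = 0"
    by (auto simp: y_def inner_sum_right orth intro!: sum.neutral)
  have y': "\<beta> \<bullet> y \<noteq> 0" if "\<beta> \<in> P" for \<beta>
    using c[OF that] by (simp add: y_def inner_commute)
  have "q X = 0" if X: "cpair \<alpha> X = 0" for X
  proof -
    have "\<forall>\<^sub>F t in at (0::real). q (X + t *\<^sub>R (y, 0)) = 0"
      using eventually_regular_line[OF insert.hyps(1) y', of X]
    proof (rule eventually_mono)
      fix t assume t: "\<forall>\<beta>\<in>P. cpair \<beta> (X + t *\<^sub>R (y, 0)) \<noteq> 0"
      have "cpair \<alpha> (X + t *\<^sub>R (y, 0)) = 0"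
        by (simp add: cpair_add_right cpair_scaleR_right X cpair_real y del: scaleR_Pair)
      then have "f (X + t *\<^sub>R (y, 0)) = 0" by (rule insert.prems(3)[OF insertI1])
      then show "q (X + t *\<^sub>R (y, 0)) = 0"
        using t insert.hyps(1) by (simp add: q(2) prod_zero_iff)
    qed
    then have "((\<lambda>t. q (X + t *\<^sub>R (y, 0))) \<longlongrightarrow> 0) (at (0::real))"
      by (rule tendsto_eventually)
    then show "q X = 0"
      using holo_tendsto_line[OF q(1)] tendsto_unique[OF trivial_limit_at] by blast
  qed
  then obtain p where "holo p" "\<And>X. q X = cpair \<alpha> X * p X"
    using holo_divide_root[OF q(1) a] by blast
  then show ?case using q insert.hyps by (intro exI[of _ p]) (simp add: mult_ac)
qed

section \<open>Derivatives in real directions\<close>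

lemma dir_deriv_holo:
  assumes "holo E"
  shows "dir_deriv \<xi> (\<lambda>x. E (x, 0)) = (\<lambda>x. cderiv (\<xi>, 0) E (x, 0))"
proof
  fix x
  have "((\<lambda>t. (x + t *\<^sub>R \<xi>, 0::'a)) has_derivative (\<lambda>h. h *\<^sub>R (\<xi>, 0))) (at 0)"
    by (auto intro!: derivative_eq_intros has_derivative_Pair)
  then have "((\<lambda>t. E (x + t *\<^sub>R \<xi>, 0)) has_derivative (\<lambda>h. cderiv (h *\<^sub>R (\<xi>, 0)) E (x, 0))) (at 0)"
    using has_derivative_compose[where g = E, OF _ holo_has_derivative[OF assms]] by fastforce
  then have "((\<lambda>t. E (x + t *\<^sub>R \<xi>, 0)) has_vector_derivative cderiv (\<xi>, 0) E (x, 0)) (at 0)"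
    by (simp add: has_vector_derivative_def cderiv_scaleR[OF assms] del: scaleR_Pair)
  then show "dir_deriv \<xi> (\<lambda>x. E (x, 0)) x = cderiv (\<xi>, 0) E (x, 0)"
    unfolding dir_deriv_def by (rule vector_derivative_at)
qed

lemma smooth_holo:
  assumes "holo E"
  shows "smooth (\<lambda>x. E (x, 0))"
proof -
  have "C_k n (\<lambda>x. E (x, 0))" for n
    using assms
  proof (induction n arbitrary: E)
    case 0
    then show ?case
      by (auto intro!: holo_continuous_compose continuous_intros)
  next
    case (Suc n)
    have "(\<lambda>x. E (x, 0)) differentiable (at x)" for x
    proof -
      have "((\<lambda>x. (x, 0::'a)) has_derivative (\<lambda>h. (h, 0))) (at x)"
        by (auto intro!: derivative_eq_intros has_derivative_Pair)
      then show ?thesis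
        using has_derivative_compose[of "\<lambda>x. (x, 0)", OF _ holo_has_derivative[OF Suc.prems]]
        unfolding differentiable_def by blast
    qed
    then show ?case
      using Suc by (auto simp: dir_deriv_holo holo_cderiv)
  qed
  then show ?thesis by (simp add: smooth_def)
qed

lemma holo_foldr_cderiv: "holo E \<Longrightarrow> holo (foldr (\<lambda>\<xi>. cderiv (\<xi>, 0)) \<xi>s E)"
  by (induction \<xi>s) (auto intro: holo_cderiv)

lemma foldr_dir_deriv_holo:
  assumes "holo E"
  shows "foldr dir_deriv \<xi>s (\<lambda>x. E (x, 0)) = (\<lambda>x. foldr (\<lambda>\<xi>. cderiv (\<xi>, 0)) \<xi>s E (x, 0))"
  by (induction \<xi>s) (simp_all add: dir_deriv_holo holo_foldr_cderiv[OF assms])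

text \<open>Each derivative is estimated on a circle of radius \<open>r\<close>, so \<open>k\<close> derivatives in real directions use the
values of \<open>E\<close> within complex distance \<open>k r\<close> and cost a factor \<open>1 / r\<close> each.\<close>

lemma iterated_Cauchy_estimate:
  fixes E :: "'a::euclidean_space \<times> 'a \<Rightarrow> complex" and r :: real
  assumes "holo E" "r > 0" "\<And>\<xi>. \<xi> \<in> set \<xi>s \<Longrightarrow> norm \<xi> = 1"
    and "\<And>Y. norm Y \<le> real (length \<xi>s) * r \<Longrightarrow> cmod (E (X + Y)) \<le> M"
  shows "cmod (foldr (\<lambda>\<xi>. cderiv (\<xi>, 0)) \<xi>s E X) \<le> M / r ^ length \<xi>s"
  using assms(3-)
proof (induction \<xi>s arbitrary: X)
  case Nil
  show ?case using Nil(2)[of 0] by simp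
next
  case (Cons \<xi> \<xi>s)
  let ?G = "foldr (\<lambda>\<xi>. cderiv (\<xi>, 0)) \<xi>s E"
  have G: "holo ?G" by (rule holo_foldr_cderiv[OF assms(1)])
  have "cmod (cderiv (r *\<^sub>R (\<xi>, 0)) ?G X) \<le> M / r ^ length \<xi>s"
  proof (rule norm_cderiv_le[OF G])
    fix z :: complex assume z: "cmod z = 1"
    have "norm (cscale z (r *\<^sub>R (\<xi>, 0 :: 'a))) = r"
      using Cons.prems(1)[of \<xi>] assms(2) z by (simp add: norm_cscale norm_Pair)
    then have le: "norm (cscale z (r *\<^sub>R (\<xi>, 0)) + Y) \<le> real (length (\<xi> # \<xi>s)) * r"
      if "norm Y \<le> real (length \<xi>s) * r" for Y
      using that norm_triangle_ineq[of "cscale z (r *\<^sub>R (\<xi>, 0))" Y] by (simp add: algebra_simps)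
    show "cmod (?G (X + cscale z (r *\<^sub>R (\<xi>, 0)))) \<le> M / r ^ length \<xi>s"
      by (rule Cons.IH) (use Cons.prems le in \<open>auto simp: add.assoc simp del: scaleR_Pair\<close>)
  qed
  then show ?case
    using assms(2) by (simp add: cderiv_scaleR[OF G] norm_mult field_simps del: scaleR_Pair)
qed

section \<open>Weyl alternants with complex arguments\<close>

text \<open>The complex-linear extension of a real linear map.\<close>

definition cmap :: "('a \<Rightarrow> 'a) \<Rightarrow> 'a \<times> 'a \<Rightarrow> 'a \<times> 'a" where
  "cmap w L = (w (fst L), w (snd L))"

text \<open>The complex-bilinear (not Hermitian) extension of the inner product.\<close>

definition bpair :: "'a::real_inner \<times> 'a \<Rightarrow> 'a \<times> 'a \<Rightarrow> complex" where
  "bpair L X = cpair (fst L) X + \<i> * cpair (snd L) X"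

lemma bpair_add_left: "bpair (L + M) X = bpair L X + bpair M X"
  by (simp add: bpair_def cpair_add_left algebra_simps)

lemma bpair_cscale_left: "bpair (cscale z L) X = z * bpair L X"
  by (simp add: bpair_def cscale_def cpair_def complex_eq_iff algebra_simps)

lemma bpair_scaleR_left: "bpair (r *\<^sub>R L) X = of_real r * bpair L X"
  using bpair_cscale_left[of "of_real r"] by (simp add: cscale_of_real)

lemma bpair_scaleR_right: "bpair L (r *\<^sub>R X) = of_real r * bpair L X"
  by (simp add: bpair_def cpair_scaleR_right scaleR_conv_of_real algebra_simps)

lemma bpair_real: "bpair (\<eta>, 0) X = cpair \<eta> X"
  by (simp add: bpair_def)

lemma cmap_comp: "cmap (u \<circ> w) L = cmap u (cmap w L)"
  by (simp add: cmap_def)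

lemma cmap_cscale: "linear w \<Longrightarrow> cmap w (cscale z L) = cscale z (cmap w L)"
  by (simp add: cmap_def cscale_def linear_add linear_diff linear_scale)

lemma cmap_add: "linear w \<Longrightarrow> cmap w (L + M) = cmap w L + cmap w M"
  by (simp add: cmap_def linear_add)

lemma cmap_scaleR: "linear w \<Longrightarrow> cmap w (r *\<^sub>R L) = r *\<^sub>R cmap w L"
  by (simp add: cmap_def linear_scale)

lemma cmap_real: "linear w \<Longrightarrow> cmap w (\<eta>, 0) = (w \<eta>, 0)"
  by (simp add: cmap_def linear_0)

lemma cpair_cmap:
  assumes "w \<in> weyl_group \<Phi>" "v \<circ> w = id" "w \<circ> v = id"
  shows "cpair \<alpha> (cmap w L) = cpair (v \<alpha>) L"
  using weyl_group_adjoint[OF assms, of _ \<alpha>] by (simp add: cpair_def cmap_def inner_commute)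

lemma cmap_reflection_fixes: "cpair \<alpha> X = 0 \<Longrightarrow> cmap (root_reflection \<alpha>) X = X"
  by (cases X) (simp add: cpair_def cmap_def complex_eq_iff root_reflection_eq)

lemma bpair_cmap_reflection:
  "bpair (cmap (root_reflection \<alpha>) L) X = bpair L (cmap (root_reflection \<alpha>) X)"
  by (simp add: bpair_def cpair_def cmap_def root_reflection_adjoint)

definition calternant :: "'a::euclidean_space set \<Rightarrow> 'a \<times> 'a \<Rightarrow> 'a \<times> 'a \<Rightarrow> complex" where
  "calternant \<Phi> L X =
     (\<Sum>w\<in>weyl_group \<Phi>. of_real (lin_det w) * exp (\<i> * bpair (cmap w L) X))"

lemma calternant_real: "calternant \<Phi> (l, 0) (x, 0) = weyl_alternant \<Phi> l x"
  by (auto simp: calternant_def weyl_alternant_def cmap_real weyl_group_linear bpair_real cpair_real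
      intro!: sum.cong)

text \<open>A reflection that fixes \<open>L\<close> can be inserted into every term and reverses its sign.\<close>

lemma calternant_eq_0_left:
  assumes "reduced_root_system \<Phi>" "\<alpha> \<in> \<Phi>" "cpair \<alpha> L = 0"
  shows "calternant \<Phi> L X = 0"
proof -
  let ?s = "root_reflection \<alpha>"
  let ?f = "\<lambda>w. of_real (lin_det w) * exp (\<i> * bpair (cmap w L) X)"
  have "calternant \<Phi> L X = (\<Sum>w\<in>weyl_group \<Phi>. ?f (w \<circ> ?s))"
    unfolding calternant_def
    by (rule sum.reindex_bij_betw[symmetric])
      (rule bij_betw_weyl_group_compose_right[OF weyl_group_reflection[OF assms(2)]])
  also have "\<dots> = (\<Sum>w\<in>weyl_group \<Phi>. - ?f w)"
    by (intro sum.cong refl)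
      (simp add: lin_det_compose weyl_group_linear lin_det_root_reflection root_nonzero[OF assms(1,2)]
        cmap_comp cmap_reflection_fixes[OF assms(3)] del: comp_apply)
  also have "\<dots> = - calternant \<Phi> L X"
    by (simp add: calternant_def sum_negf)
  finally show ?thesis by simp
qed

lemma calternant_eq_0_right:
  assumes "reduced_root_system \<Phi>" "\<alpha> \<in> \<Phi>" "cpair \<alpha> X = 0"
  shows "calternant \<Phi> L X = 0"
proof -
  let ?s = "root_reflection \<alpha>"
  let ?f = "\<lambda>w. of_real (lin_det w) * exp (\<i> * bpair (cmap w L) X)"
  have "calternant \<Phi> L X = (\<Sum>w\<in>weyl_group \<Phi>. ?f (?s \<circ> w))"
    unfolding calternant_def
    by (rule sum.reindex_bij_betw[symmetric])
      (rule bij_betw_weyl_group_compose_left[OF weyl_group_reflection[OF assms(2)]])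
  also have "\<dots> = (\<Sum>w\<in>weyl_group \<Phi>. - ?f w)"
    by (intro sum.cong refl)
      (simp add: lin_det_compose linear_root_reflection lin_det_root_reflection root_nonzero[OF assms(1,2)]
        cmap_comp bpair_cmap_reflection cmap_reflection_fixes[OF assms(3)] del: comp_apply)
  also have "\<dots> = - calternant \<Phi> L X"
    by (simp add: calternant_def sum_negf)
  finally show ?thesis by simp
qed

text \<open>Grouping the Weyl group by cosets writes the alternant of \<open>\<Phi>\<close> through those of a
subsystem. Summing over the whole group instead of over cosets avoids coset representatives and
only produces the factor on the left.\<close>

lemma calternant_subsystem:
  assumes "reduced_root_system \<Phi>" "\<Psi> \<subseteq> \<Phi>"
  shows "of_nat (card (weyl_group \<Psi>)) * calternant \<Phi> L X =
    (\<Sum>w\<in>weyl_group \<Phi>. of_real (lin_det w) * calternant \<Psi> (cmap w L) X)"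
proof -
  let ?f = "\<lambda>w. of_real (lin_det w) * exp (\<i> * bpair (cmap w L) X)"
  have "(\<Sum>w\<in>weyl_group \<Phi>. of_real (lin_det w) * calternant \<Psi> (cmap w L) X)
      = (\<Sum>w\<in>weyl_group \<Phi>. \<Sum>u\<in>weyl_group \<Psi>. ?f (u \<circ> w))"
    unfolding calternant_def sum_distrib_left
    by (intro sum.cong refl)
      (simp add: lin_det_compose weyl_group_linear cmap_comp mult_ac del: comp_apply)
  also have "\<dots> = (\<Sum>u\<in>weyl_group \<Psi>. \<Sum>w\<in>weyl_group \<Phi>. ?f (u \<circ> w))"
    by (rule sum.swap)
  also have "\<dots> = (\<Sum>u\<in>weyl_group \<Psi>. calternant \<Phi> L X)"
    unfolding calternant_def
    by (intro sum.cong refl sum.reindex_bij_betw bij_betw_weyl_group_compose_left)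
      (rule weyl_group_mono[OF assms(2)])
  finally show ?thesis by simp
qed

section \<open>The gain from the zeros in the spectral variable\<close>

text \<open>The zeros of the linear factors are pairwise distinct, so they can be divided out one at a time.\<close>

lemma factor_out_zeros:
  fixes h :: "complex \<Rightarrow> complex"
  assumes "finite S" "h holomorphic_on UNIV" "\<And>s. s \<in> S \<Longrightarrow> b s \<noteq> 0"
    and "\<And>s z. s \<in> S \<Longrightarrow> a s + z * b s = 0 \<Longrightarrow> h z = 0"
    and "\<And>s t. s \<in> S \<Longrightarrow> t \<in> S \<Longrightarrow> s \<noteq> t \<Longrightarrow> a s * b t \<noteq> a t * b s"
  shows "\<exists>q. q holomorphic_on UNIV \<and> (\<forall>z. h z = (\<Prod>s\<in>S. a s + z * b s) * q z)"
  using assms(1,3-)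
proof (induction S rule: finite_induct)
  case empty
  then show ?case using assms(2) by auto
next
  case (insert s S)
  have "\<exists>q. q holomorphic_on UNIV \<and> (\<forall>z. h z = (\<Prod>s\<in>S. a s + z * b s) * q z)"
  proof (rule insert.IH)
    show "h z = 0" if "t \<in> S" "a t + z * b t = 0" for t z
      by (rule insert.prems(2)[of t]) (use that in auto)
  qed (use insert.prems(1,3) in auto)
  then obtain q where q: "q holomorphic_on UNIV" "\<And>z. h z = (\<Prod>s\<in>S. a s + z * b s) * q z"
    by blast
  define z0 where "z0 = - a s / b s"
  have b: "b s \<noteq> 0" using insert.prems(1) by simp
  have z0: "a s + z0 * b s = 0" using b by (simp add: z0_def)
  have "a t + z0 * b t \<noteq> 0" if "t \<in> S" for t
  proof
    assume "a t + z0 * b t = 0"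
    then have "a s * b t = a t * b s" using b by (simp add: z0_def field_simps)
    then show False using insert.prems(3)[of s t] that insert.hyps by auto
  qed
  then have "(\<Prod>s\<in>S. a s + z0 * b s) \<noteq> 0" using insert.hyps by (simp add: prod_zero_iff)
  moreover have "h z0 = 0" using insert.prems(2)[of s z0] z0 by simp
  ultimately have qz0: "q z0 = 0" using q(2)[of z0] by simp
  define p where "p z = (if z = z0 then deriv q z0 else (q z - q z0) / (z - z0))" for z
  have "p holomorphic_on UNIV"
    unfolding p_def by (rule pole_lemma_open[OF q(1) open_UNIV])
  then have "(\<lambda>z. p z / b s) holomorphic_on UNIV"
    using b by (intro holomorphic_intros) auto
  moreover have "q z = (a s + z * b s) * (p z / b s)" for z
  proof (cases "z = z0")
    case False
    have "a s + z * b s = b s * (z - z0)" using b by (simp add: z0_def field_simps)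
    then show ?thesis using False b by (simp add: p_def qz0)
  qed (use qz0 z0 in auto)
  then have "h z = (\<Prod>s\<in>insert s S. a s + z * b s) * (p z / b s)" for z
    using q(2)[of z] insert.hyps by (simp add: mult_ac)
  ultimately show ?case by blast
qed

text \<open>A form of the Schwarz lemma: divide out the zeros and apply the maximum principle to the quotient.\<close>

lemma norm_le_prod_zeros:
  fixes h :: "complex \<Rightarrow> complex"
  assumes "finite S" "h holomorphic_on UNIV" "\<And>s. s \<in> S \<Longrightarrow> b s \<noteq> 0"
    and "\<And>s z. s \<in> S \<Longrightarrow> a s + z * b s = 0 \<Longrightarrow> h z = 0"
    and "\<And>s t. s \<in> S \<Longrightarrow> t \<in> S \<Longrightarrow> s \<noteq> t \<Longrightarrow> a s * b t \<noteq> a t * b s"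
    and "\<rho> > 0" "\<And>s z. s \<in> S \<Longrightarrow> cmod z = \<rho> \<Longrightarrow> cmod (a s + z * b s) \<ge> 1"
    and M: "\<And>z. cmod z = \<rho> \<Longrightarrow> cmod (h z) \<le> M"
  shows "cmod (h 0) \<le> M * (\<Prod>s\<in>S. cmod (a s))"
proof -
  obtain q where q: "q holomorphic_on UNIV" "\<And>z. h z = (\<Prod>s\<in>S. a s + z * b s) * q z"
    using factor_out_zeros[of S h b a] assms(1-5) by blast
  have "cmod ((deriv ^^ 0) q 0) \<le> fact 0 * M / \<rho> ^ 0"
  proof (rule Cauchy_inequality)
    show "q holomorphic_on ball 0 \<rho>" "continuous_on (cball 0 \<rho>) q"
      using q(1) by (auto intro: holomorphic_on_subset holomorphic_on_imp_continuous_on)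
    fix z assume "cmod (0 - z) = \<rho>"
    then have z: "cmod z = \<rho>" by simp
    have "1 \<le> (\<Prod>s\<in>S. cmod (a s + z * b s))"
      using assms(7) z by (intro prod_ge_1) auto
    then have "cmod (q z) \<le> cmod (h z)"
      by (simp add: q(2) norm_mult prod_norm mult_left_le_one_le mult_le_cancel_right1)
    then show "cmod (q z) \<le> M" using M[OF z] by simp
  qed (use assms in auto)
  then have "cmod (q 0) \<le> M" by simp
  then show ?thesis
    using q(2)[of 0] by (simp add: norm_mult prod_norm mult.commute mult_right_mono prod_nonneg)
qed

lemma regular_combination:
  fixes \<Phi> :: "'a::euclidean_space set"
  assumes "finite \<Phi>" "0 \<notin> \<Phi>"
  shows "\<exists>c. \<forall>\<alpha>\<in>\<Phi>. \<bar>\<alpha> \<bullet> (\<Sum>\<beta>\<in>\<Phi>. c \<beta> *\<^sub>R \<beta>)\<bar> \<ge> 2"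
proof -
  have "\<exists>c. (\<forall>\<beta>\<in>\<Phi>. 0 \<le> c \<beta> \<and> c \<beta> < 1) \<and> (\<forall>\<alpha>\<in>\<Phi>. (0 + (\<Sum>\<beta>\<in>\<Phi>. c \<beta> *\<^sub>R \<beta>)) \<bullet> \<alpha> \<noteq> 0)"
    by (rule generic_combination) (use assms in force)+
  then obtain c where c: "\<And>\<alpha>. \<alpha> \<in> \<Phi> \<Longrightarrow> (\<Sum>\<beta>\<in>\<Phi>. c \<beta> *\<^sub>R \<beta>) \<bullet> \<alpha> \<noteq> 0"
    unfolding add_0_left by blast
  define y where "y = (\<Sum>\<beta>\<in>\<Phi>. c \<beta> *\<^sub>R \<beta>)"
  define \<kappa> where "\<kappa> = Min (insert 1 ((\<lambda>\<alpha>. \<bar>\<alpha> \<bullet> y\<bar>) ` \<Phi>))"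
  have pos: "\<kappa> > 0" using assms(1) c by (auto simp: \<kappa>_def y_def inner_commute)
  have le: "\<kappa> \<le> \<bar>\<alpha> \<bullet> y\<bar>" if "\<alpha> \<in> \<Phi>" for \<alpha>
    unfolding \<kappa>_def using assms(1) that by (intro Min_le) auto
  have "(\<Sum>\<beta>\<in>\<Phi>. ((2 / \<kappa>) * c \<beta>) *\<^sub>R \<beta>) = (2 / \<kappa>) *\<^sub>R y"
    by (simp add: y_def scaleR_sum_right)
  then show ?thesis
    using le pos by (intro exI[of _ "\<lambda>\<beta>. (2 / \<kappa>) * c \<beta>"]) (simp add: abs_mult field_simps)
qed

text \<open>A direction \<open>\<eta>\<close> in which the spectral variable may be moved by a bounded amount: the pairings of the
roots with it change boundedly, and so do the exponents \<open>\<langle>w\<lambda>, X\<rangle>\<close> as long as all \<open>\<alpha>(X)\<close> are bounded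
by \<open>1\<close>. The second point needs \<open>\<eta>\<close> to be in the span of the roots, since the component of \<open>X\<close>
orthogonal to the roots is arbitrary.\<close>

definition transverse ::
  "'a::euclidean_space set \<Rightarrow> real \<Rightarrow> 'a \<Rightarrow> bool" where
  "transverse \<Phi> D \<eta> \<longleftrightarrow> (\<forall>\<alpha>\<in>\<Phi>. \<bar>\<alpha> \<bullet> \<eta>\<bar> \<le> D) \<and>
     (\<forall>w\<in>weyl_group \<Phi>. \<forall>X. (\<forall>\<alpha>\<in>\<Phi>. cmod (cpair \<alpha> X) \<le> 1) \<longrightarrow> cmod (cpair (w \<eta>) X) \<le> D)"

lemma transverseD:
  assumes "transverse \<Phi> D \<eta>"
  shows "\<alpha> \<in> \<Phi> \<Longrightarrow> \<bar>\<alpha> \<bullet> \<eta>\<bar> \<le> D"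
    and "w \<in> weyl_group \<Phi> \<Longrightarrow> \<forall>\<alpha>\<in>\<Phi>. cmod (cpair \<alpha> X) \<le> 1 \<Longrightarrow> cmod (cpair (w \<eta>) X) \<le> D"
  using assms unfolding transverse_def by blast+

lemma transverse_combination:
  assumes rs: "reduced_root_system \<Phi>" and c: "\<And>\<beta>. \<beta> \<in> \<Phi> \<Longrightarrow> \<bar>c \<beta>\<bar> \<le> K"
    and "K \<ge> 0" and D: "D \<ge> K * real (card \<Phi>)" "D \<ge> K * (\<Sum>\<beta>\<in>\<Phi>. norm \<beta>)\<^sup>2"
  shows "transverse \<Phi> D (\<Sum>\<beta>\<in>\<Phi>. c \<beta> *\<^sub>R \<beta>)"
  unfolding transverse_def
proof (intro conjI ballI allI impI)
  have fin: "finite \<Phi>" using rs by (simp add: reduced_root_system_def)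
  fix \<alpha> assume a: "\<alpha> \<in> \<Phi>"
  have "\<bar>\<alpha> \<bullet> (\<Sum>\<beta>\<in>\<Phi>. c \<beta> *\<^sub>R \<beta>)\<bar> \<le> (\<Sum>\<beta>\<in>\<Phi>. \<bar>c \<beta>\<bar> * \<bar>\<alpha> \<bullet> \<beta>\<bar>)"
    by (simp add: inner_sum_right) (rule order_trans[OF sum_abs], simp add: abs_mult)
  also have "\<dots> \<le> (\<Sum>\<beta>\<in>\<Phi>. K * (norm \<alpha> * norm \<beta>))"
    by (intro sum_mono mult_mono c Cauchy_Schwarz_ineq2) (use \<open>K \<ge> 0\<close> in auto)
  also have "\<dots> = K * (norm \<alpha> * (\<Sum>\<beta>\<in>\<Phi>. norm \<beta>))"
    by (simp add: sum_distrib_left)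
  also have "\<dots> \<le> K * ((\<Sum>\<beta>\<in>\<Phi>. norm \<beta>) * (\<Sum>\<beta>\<in>\<Phi>. norm \<beta>))"
    using a fin \<open>K \<ge> 0\<close> by (intro mult_left_mono mult_right_mono member_le_sum sum_nonneg) auto
  finally show "\<bar>\<alpha> \<bullet> (\<Sum>\<beta>\<in>\<Phi>. c \<beta> *\<^sub>R \<beta>)\<bar> \<le> D" using D(2) by (simp add: power2_eq_square)
next
  fix w X assume w: "w \<in> weyl_group \<Phi>" and X: "\<forall>\<alpha>\<in>\<Phi>. cmod (cpair \<alpha> X) \<le> 1"
  have lin: "linear w" using w by (rule weyl_group_linear)
  have "cmod (cpair (w (\<Sum>\<beta>\<in>\<Phi>. c \<beta> *\<^sub>R \<beta>)) X) = cmod (\<Sum>\<beta>\<in>\<Phi>. c \<beta> *\<^sub>R cpair (w \<beta>) X)"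
    by (simp add: linear_sum[OF lin] linear_scale[OF lin] cpair_sum_left cpair_scaleR_left)
  also have "\<dots> \<le> (\<Sum>\<beta>\<in>\<Phi>. \<bar>c \<beta>\<bar> * cmod (cpair (w \<beta>) X))"
    by (rule order_trans[OF norm_sum]) simp
  also have "\<dots> \<le> (\<Sum>\<beta>\<in>\<Phi>. K * 1)"
    using X weyl_group_roots[OF rs w] \<open>K \<ge> 0\<close> by (intro sum_mono mult_mono c) auto
  finally show "cmod (cpair (w (\<Sum>\<beta>\<in>\<Phi>. c \<beta> *\<^sub>R \<beta>)) X) \<le> D" using D(1) by (simp add: mult.commute)
qed

text \<open>Start from a fixed regular combination of roots and perturb it slightly, depending on \<open>L\<close>, so that
the points at which the line \<open>L + z \<eta>\<close> meets the different root hyperplanes become distinct. All bounds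
are uniform in \<open>L\<close>.\<close>

lemma exists_transverse:
  fixes \<Phi> P :: "'a::euclidean_space set"
  assumes rs: "reduced_root_system \<Phi>" "positive_system \<Phi> P"
  shows "\<exists>D\<ge>0. \<forall>L. (\<forall>\<alpha>\<in>\<Phi>. cpair \<alpha> L \<noteq> 0) \<longrightarrow>
    (\<exists>\<eta>. transverse \<Phi> D \<eta> \<and> (\<forall>\<alpha>\<in>\<Phi>. \<bar>\<alpha> \<bullet> \<eta>\<bar> \<ge> 1) \<and>
      (\<forall>\<alpha>\<in>P. \<forall>\<beta>\<in>P. \<alpha> \<noteq> \<beta> \<longrightarrow>
        cpair \<alpha> L * of_real (\<beta> \<bullet> \<eta>) \<noteq> cpair \<beta> L * of_real (\<alpha> \<bullet> \<eta>)))"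
proof -
  note P = positive_system_choice[OF rs]
  have fin: "finite \<Phi>" "0 \<notin> \<Phi>" using rs(1) by (auto simp: reduced_root_system_def)
  obtain c where c: "\<And>\<alpha>. \<alpha> \<in> \<Phi> \<Longrightarrow> \<bar>\<alpha> \<bullet> (\<Sum>\<beta>\<in>\<Phi>. c \<beta> *\<^sub>R \<beta>)\<bar> \<ge> 2"
    using regular_combination[OF fin] by blast
  define y0 where "y0 = (\<Sum>\<beta>\<in>\<Phi>. c \<beta> *\<^sub>R \<beta>)"
  define N where "N = (\<Sum>\<beta>\<in>\<Phi>. norm \<beta>)"
  define \<delta> where "\<delta> = 1 / (1 + N\<^sup>2)"
  have pos: "0 < 1 + N\<^sup>2" by (simp add: add_pos_nonneg)
  have \<delta>: "\<delta> > 0" "\<delta> \<le> 1" "\<delta> * N\<^sup>2 \<le> 1"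
    using pos by (auto simp: \<delta>_def field_simps)
  define K where "K = (\<Sum>\<beta>\<in>\<Phi>. \<bar>c \<beta>\<bar>) + 1"
  have K: "K \<ge> 0" by (simp add: K_def sum_nonneg add_nonneg_nonneg)
  define D where "D = K * real (card \<Phi>) + K * N\<^sup>2"
  have D: "D \<ge> 0" "D \<ge> K * real (card \<Phi>)" "D \<ge> K * N\<^sup>2"
    using K by (auto simp: D_def)
  show ?thesis
  proof (intro exI[of _ D] conjI allI impI D(1))
    fix L assume L: "\<forall>\<alpha>\<in>\<Phi>. cpair \<alpha> L \<noteq> 0"
    \<comment> \<open>the line meets the hyperplanes of \<open>\<alpha>\<close> and \<open>\<beta>\<close> in the same point iff \<open>\<eta>\<close> is orthogonal to the real and
      imaginary parts \<open>u Re (\<alpha>, \<beta>)\<close> and \<open>u Im (\<alpha>, \<beta>)\<close>; at least one of the two is nonzero\<close>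
    define u where "u f p = f (cpair (fst p) L) *\<^sub>R snd p - f (cpair (snd p) L) *\<^sub>R fst p"
      for f :: "complex \<Rightarrow> real" and p
    define U where "U = (u Re ` (P \<times> P) \<union> u Im ` (P \<times> P)) - {0}"
    have "\<exists>d. (\<forall>\<beta>\<in>\<Phi>. 0 \<le> d \<beta> \<and> d \<beta> < \<delta>) \<and> (\<forall>v\<in>U. (y0 + (\<Sum>\<beta>\<in>\<Phi>. d \<beta> *\<^sub>R \<beta>)) \<bullet> v \<noteq> 0)"
    proof (rule generic_combination)
      show "finite U" using P(2) by (simp add: U_def)
      fix v assume "v \<in> U"
      then obtain f p where v: "v = u f p" "p \<in> P \<times> P" "v \<noteq> 0" by (auto simp: U_def)
      show "\<exists>\<alpha>\<in>\<Phi>. \<alpha> \<bullet> v \<noteq> 0"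
      proof (rule ccontr)
        assume "\<not> ?thesis"
        then have "fst p \<bullet> v = 0" "snd p \<bullet> v = 0" using v(2) P(1) by auto
        then have "v \<bullet> v = 0" by (subst (1) v(1)) (simp add: u_def inner_diff_left)
        then show False using v(3) by simp
      qed
    qed (use fin \<delta> in auto)
    then obtain d where d: "\<And>\<beta>. \<beta> \<in> \<Phi> \<Longrightarrow> 0 \<le> d \<beta> \<and> d \<beta> < \<delta>"
      "\<And>v. v \<in> U \<Longrightarrow> (y0 + (\<Sum>\<beta>\<in>\<Phi>. d \<beta> *\<^sub>R \<beta>)) \<bullet> v \<noteq> 0" by blast
    define \<eta> where "\<eta> = y0 + (\<Sum>\<beta>\<in>\<Phi>. d \<beta> *\<^sub>R \<beta>)"
    have \<eta>_eq: "\<eta> = (\<Sum>\<beta>\<in>\<Phi>. (c \<beta> + d \<beta>) *\<^sub>R \<beta>)"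
      by (simp add: \<eta>_def y0_def sum.distrib scaleR_left_distrib)
    have "\<bar>c \<beta> + d \<beta>\<bar> \<le> K" if "\<beta> \<in> \<Phi>" for \<beta>
      using member_le_sum[of \<beta> \<Phi> "\<lambda>\<beta>. \<bar>c \<beta>\<bar>"] that fin d(1)[OF that] \<delta>(2) by (auto simp: K_def)
    then have "transverse \<Phi> D \<eta>"
      unfolding \<eta>_eq using rs(1) K D(2,3) by (intro transverse_combination) (auto simp: N_def)
    moreover have "\<bar>\<alpha> \<bullet> \<eta>\<bar> \<ge> 1" if a: "\<alpha> \<in> \<Phi>" for \<alpha>
    proof -
      have "\<bar>\<alpha> \<bullet> (\<Sum>\<beta>\<in>\<Phi>. d \<beta> *\<^sub>R \<beta>)\<bar> \<le> (\<Sum>\<beta>\<in>\<Phi>. \<bar>d \<beta>\<bar> * \<bar>\<alpha> \<bullet> \<beta>\<bar>)"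
        by (simp add: inner_sum_right) (rule order_trans[OF sum_abs], simp add: abs_mult)
      also have "\<dots> \<le> (\<Sum>\<beta>\<in>\<Phi>. \<delta> * (norm \<alpha> * norm \<beta>))"
        using d(1) \<delta>(1) by (intro sum_mono mult_mono Cauchy_Schwarz_ineq2) (auto simp: less_imp_le)
      also have "\<dots> = \<delta> * (norm \<alpha> * N)"
        by (simp add: sum_distrib_left N_def)
      also have "\<dots> \<le> \<delta> * (N * N)"
        using a fin(1) \<delta>(1) unfolding N_def
        by (intro mult_left_mono mult_right_mono member_le_sum sum_nonneg) auto
      also have "\<dots> \<le> 1" using \<delta>(3) by (simp add: power2_eq_square)
      finally have "\<bar>\<alpha> \<bullet> (\<Sum>\<beta>\<in>\<Phi>. d \<beta> *\<^sub>R \<beta>)\<bar> \<le> 1" .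
      then show ?thesis using c[OF a] by (simp add: \<eta>_def y0_def inner_add_right)
    qed
    moreover have "cpair \<alpha> L * of_real (\<beta> \<bullet> \<eta>) \<noteq> cpair \<beta> L * of_real (\<alpha> \<bullet> \<eta>)"
      if ab: "\<alpha> \<in> P" "\<beta> \<in> P" "\<alpha> \<noteq> \<beta>" for \<alpha> \<beta>
    proof
      assume eq: "cpair \<alpha> L * of_real (\<beta> \<bullet> \<eta>) = cpair \<beta> L * of_real (\<alpha> \<bullet> \<eta>)"
      have zero: "\<eta> \<bullet> u Re (\<alpha>, \<beta>) = 0" "\<eta> \<bullet> u Im (\<alpha>, \<beta>) = 0"
        using arg_cong[OF eq, of Re] arg_cong[OF eq, of Im]
        by (simp_all add: u_def inner_diff_right inner_commute)
      have nonzero: "u f (\<alpha>, \<beta>) \<noteq> 0" if f: "f (cpair \<alpha> L) \<noteq> 0" for f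
      proof
        assume "u f (\<alpha>, \<beta>) = 0"
        then have e: "f (cpair \<alpha> L) *\<^sub>R \<beta> = f (cpair \<beta> L) *\<^sub>R \<alpha>" by (simp add: u_def)
        have "\<beta> = (1 / f (cpair \<alpha> L)) *\<^sub>R (f (cpair \<alpha> L) *\<^sub>R \<beta>)" using f by simp
        also have "\<dots> = (f (cpair \<beta> L) / f (cpair \<alpha> L)) *\<^sub>R \<alpha>" by (simp add: e)
        finally show False using positive_not_proportional[OF rs ab] by blast
      qed
      have "Re (cpair \<alpha> L) \<noteq> 0 \<or> Im (cpair \<alpha> L) \<noteq> 0"
        using L ab(1) P(1) by (auto simp: complex_eq_iff)
      then have "u Re (\<alpha>, \<beta>) \<in> U \<or> u Im (\<alpha>, \<beta>) \<in> U"
        using nonzero ab by (auto simp: U_def)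
      then show False using d(2) zero unfolding \<eta>_def by blast
    qed
    ultimately show "\<exists>\<eta>. transverse \<Phi> D \<eta> \<and> (\<forall>\<alpha>\<in>\<Phi>. \<bar>\<alpha> \<bullet> \<eta>\<bar> \<ge> 1) \<and>
      (\<forall>\<alpha>\<in>P. \<forall>\<beta>\<in>P. \<alpha> \<noteq> \<beta> \<longrightarrow>
        cpair \<alpha> L * of_real (\<beta> \<bullet> \<eta>) \<noteq> cpair \<beta> L * of_real (\<alpha> \<bullet> \<eta>))" by blast
  qed
qed

text \<open>The alternant vanishes at the points where the line \<open>L + z \<eta>\<close> meets the root hyperplanes. The roots
with \<open>|\<langle>L, \<alpha>\<rangle>| \<le> 1\<close> have their zero inside the circle \<open>|z| = 2\<close>, at a distance from it because
\<open>|\<langle>\<eta>, \<alpha>\<rangle>| \<ge> 1\<close>; each of them contributes a factor \<open>|\<langle>L, \<alpha>\<rangle>|\<close> at the centre.\<close>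

lemma calternant_gain:
  fixes \<Phi> P :: "'a::euclidean_space set"
  assumes rs: "reduced_root_system \<Phi>" "positive_system \<Phi> P"
    and \<eta>: "\<And>\<alpha>. \<alpha> \<in> \<Phi> \<Longrightarrow> \<bar>\<alpha> \<bullet> \<eta>\<bar> \<ge> 1"
    "\<And>\<alpha> \<beta>. \<alpha> \<in> P \<Longrightarrow> \<beta> \<in> P \<Longrightarrow> \<alpha> \<noteq> \<beta> \<Longrightarrow>
      cpair \<alpha> L * of_real (\<beta> \<bullet> \<eta>) \<noteq> cpair \<beta> L * of_real (\<alpha> \<bullet> \<eta>)"
    and M: "\<And>z. cmod z = 2 \<Longrightarrow> cmod (calternant \<Phi> (L + cscale z (\<eta>, 0)) X) \<le> M"
  shows "cmod (calternant \<Phi> L X) \<le> M * (\<Prod>\<alpha>\<in>P. min 1 (cmod (cpair \<alpha> L)))"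
proof -
  note P = positive_system_choice[OF rs]
  let ?S = "{\<alpha>\<in>P. cmod (cpair \<alpha> L) \<le> 1}"
  let ?h = "\<lambda>z. calternant \<Phi> (L + cscale z (\<eta>, 0)) X"
  have pair: "cpair \<alpha> (L + cscale z (\<eta>, 0)) = cpair \<alpha> L + z * of_real (\<alpha> \<bullet> \<eta>)" for \<alpha> z
    by (simp add: cpair_add_right cpair_cscale cpair_real)
  have "?h z = (\<Sum>w\<in>weyl_group \<Phi>. of_real (lin_det w) *
      exp (\<i> * (bpair (cmap w L) X + z * bpair (cmap w (\<eta>, 0)) X)))" for z
    unfolding calternant_def
    by (intro sum.cong refl)
      (simp add: cmap_add cmap_cscale weyl_group_linear bpair_add_left bpair_cscale_left)
  then have hol: "?h holomorphic_on UNIV"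
    by (simp only:) (intro holomorphic_intros)
  have "cmod (?h 0) \<le> M * (\<Prod>\<alpha>\<in>?S. cmod (cpair \<alpha> L))"
  proof (rule norm_le_prod_zeros[where \<rho> = 2 and b = "\<lambda>\<alpha>. of_real (\<alpha> \<bullet> \<eta>)"])
    show "complex_of_real (\<alpha> \<bullet> \<eta>) \<noteq> 0" if "\<alpha> \<in> ?S" for \<alpha>
      using that \<eta>(1)[of \<alpha>] P(1) by auto
    show "?h z = 0" if "\<alpha> \<in> ?S" "cpair \<alpha> L + z * of_real (\<alpha> \<bullet> \<eta>) = 0" for \<alpha> z
      using that P(1) by (intro calternant_eq_0_left[OF rs(1), of \<alpha>]) (auto simp: pair)
    show "1 \<le> cmod (cpair \<alpha> L + z * of_real (\<alpha> \<bullet> \<eta>))" if "\<alpha> \<in> ?S" "cmod z = 2" for \<alpha> z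
    proof -
      have "2 * 1 \<le> cmod (z * of_real (\<alpha> \<bullet> \<eta>))"
        unfolding norm_mult that(2) using \<eta>(1)[of \<alpha>] that(1) P(1) by (intro mult_left_mono) auto
      then show ?thesis
        using that(1) norm_diff_ineq[of "z * of_real (\<alpha> \<bullet> \<eta>)" "cpair \<alpha> L"]
        by (simp add: add.commute)
    qed
  qed (use P(2) \<eta>(2) hol M in auto)
  also have "(\<Prod>\<alpha>\<in>?S. cmod (cpair \<alpha> L)) = (\<Prod>\<alpha>\<in>P. min 1 (cmod (cpair \<alpha> L)))"
    using P(2) by (subst prod.inter_filter) (auto intro!: prod.cong)
  finally show ?thesis by (simp add: cscale_0)
qed

section \<open>Reflection-closed sets of small roots\<close>

text \<open>A pigeonhole argument on scales: among the sublevel sets for a geometric progression of thresholds,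
two more of them than there are roots, two consecutive ones coincide. Reflecting one root of such a
set in another multiplies the threshold by at most the ratio of the progression, so the set is
closed under reflections. The progression starts so low that the threshold remains below \<open>1\<close>.\<close>

lemma exists_reflection_closed_sublevel:
  fixes \<Phi> :: "'a::euclidean_space set" and f :: "'a \<Rightarrow> real"
  assumes rs: "reduced_root_system \<Phi>" and "K \<ge> 0"
    and refl: "\<And>\<alpha> \<beta>. \<alpha> \<in> \<Phi> \<Longrightarrow> \<beta> \<in> \<Phi> \<Longrightarrow> f (root_reflection \<alpha> \<beta>) \<le> f \<beta> + K * f \<alpha>"
  shows "\<exists>\<tau>. (1 / (K + 2)) ^ (card \<Phi> + 2) \<le> \<tau> \<and> \<tau> < 1 \<and> reduced_root_system {\<alpha>\<in>\<Phi>. f \<alpha> \<le> \<tau>}"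
proof -
  have fin: "finite \<Phi>" using rs by (simp add: reduced_root_system_def)
  define c where "c = K + 2"
  have c: "c > 1" "c \<ge> 1" using assms(2) by (auto simp: c_def)
  define \<epsilon> where "\<epsilon> = (1 / c) ^ (card \<Phi> + 2)"
  have \<epsilon>: "\<epsilon> > 0" using c by (simp add: \<epsilon>_def)
  define S where "S j = {\<alpha>\<in>\<Phi>. f \<alpha> \<le> c ^ j * \<epsilon>}" for j
  have mono: "S j \<subseteq> S (Suc j)" for j
  proof -
    have "c ^ j * \<epsilon> \<le> c ^ Suc j * \<epsilon>" using c \<epsilon> by (intro mult_right_mono power_increasing) auto
    then show ?thesis by (auto simp: S_def)
  qed
  have finS: "finite (S j)" for j using fin by (simp add: S_def)
  have "\<exists>j\<le>card \<Phi>. S j = S (Suc j)"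
  proof (rule ccontr)
    assume *: "\<not> ?thesis"
    have "j \<le> card \<Phi> + 1 \<Longrightarrow> j \<le> card (S j)" for j
    proof (induction j)
      case (Suc j)
      then have "S j \<subset> S (Suc j)" using * mono by auto
      then have "card (S j) < card (S (Suc j))" by (rule psubset_card_mono[OF finS])
      then show ?case using Suc by simp
    qed simp
    then have "card \<Phi> + 1 \<le> card (S (card \<Phi> + 1))" by blast
    moreover have "card (S (card \<Phi> + 1)) \<le> card \<Phi>"
      using fin by (intro card_mono) (auto simp: S_def)
    ultimately show False by simp
  qed
  then obtain j where j: "j \<le> card \<Phi>" "S j = S (Suc j)" by blast
  define \<tau> where "\<tau> = c ^ j * \<epsilon>"
  have "\<epsilon> \<le> \<tau>" using c \<epsilon> by (simp add: \<tau>_def)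
  moreover have "\<tau> < 1"
  proof -
    have "c ^ j < c ^ (card \<Phi> + 2)" using c j by (intro power_strict_increasing) auto
    then show ?thesis using c by (simp add: \<tau>_def \<epsilon>_def power_divide field_simps)
  qed
  moreover have "reduced_root_system (S j)"
  proof -
    have "root_reflection \<alpha> \<beta> \<in> S j" if "\<alpha> \<in> S j" "\<beta> \<in> S j" for \<alpha> \<beta>
    proof -
      have ab: "\<alpha> \<in> \<Phi>" "\<beta> \<in> \<Phi>" "f \<alpha> \<le> \<tau>" "f \<beta> \<le> \<tau>" using that by (auto simp: S_def \<tau>_def)
      have "f (root_reflection \<alpha> \<beta>) \<le> \<tau> + K * \<tau>"
        using refl[OF ab(1,2)] ab(4) mult_left_mono[OF ab(3) assms(2)] by simp
      also have "\<dots> \<le> c * \<tau>" using \<epsilon> \<open>\<epsilon> \<le> \<tau>\<close> by (simp add: c_def algebra_simps)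
      finally have "root_reflection \<alpha> \<beta> \<in> S (Suc j)"
        using rs ab(1,2) by (auto simp: S_def \<tau>_def reduced_root_system_def mult.assoc)
      then show ?thesis using j(2) by simp
    qed
    then show ?thesis
      using rs finS[of j] unfolding reduced_root_system_def by (auto simp: S_def)
  qed
  ultimately show ?thesis unfolding S_def \<tau>_def \<epsilon>_def c_def by blast
qed

section \<open>The estimate for alternants\<close>

definition damp :: "real \<Rightarrow> real" where "damp t = t / (1 + t)"

lemma damp_nonneg: "t \<ge> 0 \<Longrightarrow> damp t \<ge> 0"
  by (simp add: damp_def)

text \<open>The shape of the bound is chosen to be symmetric in \<open>L\<close> and \<open>X\<close> and invariant under
\<open>(L, X) \<mapsto> (m L, X / m)\<close>. The hypothesis on the imaginary parts says that all exponentials in the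
alternant are bounded, and it is inherited by subsystems.\<close>

definition alternant_bounded :: "'a::euclidean_space set \<Rightarrow> 'a set \<Rightarrow> real \<Rightarrow> real \<Rightarrow> bool" where
  "alternant_bounded \<Phi> P R C \<longleftrightarrow> (\<forall>L X. (\<forall>w\<in>weyl_group \<Phi>. \<bar>Im (bpair (cmap w L) X)\<bar> \<le> R) \<longrightarrow>
     cmod (calternant \<Phi> L X) \<le>
       C * (\<Sum>w\<in>weyl_group \<Phi>. \<Prod>\<alpha>\<in>P. damp (cmod (cpair \<alpha> X) * cmod (cpair \<alpha> (cmap w L)))))"

text \<open>The effect on one factor of moving the spectral variable by a bounded amount.\<close>

lemma damp_shift:
  assumes "0 \<le> a" "a \<le> 1" "0 \<le> b" "0 \<le> b'" "b' \<le> b + D" "0 \<le> D"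
  shows "damp (a * b') \<le> (1 + D) * (a * (1 + b) / (1 + a * b))"
proof -
  have ab: "a * b' \<le> a * (b + D)" "0 \<le> a * b" "0 \<le> a * b'" "0 \<le> a * D"
    using assms by (auto intro: mult_left_mono)
  have "damp (a * b') \<le> damp (a * (b + D))"
    using ab by (simp add: damp_def field_simps)
  also have "\<dots> \<le> a * (b + D) / (1 + a * b)"
  proof -
    have "0 < 1 + a * b" using ab(2) by linarith
    then show ?thesis unfolding damp_def distrib_left using ab by (intro frac_le) auto
  qed
  also have "\<dots> \<le> (1 + D) * (a * (1 + b)) / (1 + a * b)"
  proof (rule divide_right_mono)
    have "a * (b + D) \<le> a * ((1 + D) * (1 + b))"
      using assms by (intro mult_left_mono) (auto simp: algebra_simps)
    then show "a * (b + D) \<le> (1 + D) * (a * (1 + b))" by (simp add: mult_ac)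
  qed (use ab in auto)
  finally show ?thesis by simp
qed

text \<open>For a root in the subsystem, the gain \<open>damp b\<close> exactly undoes the loss in \<open>damp_shift\<close>.\<close>

lemma damp_near_wall:
  assumes "0 \<le> a" "0 \<le> b"
  shows "damp b * (a * (1 + b) / (1 + a * b)) = damp (a * b)"
  using assms by (simp add: damp_def)

text \<open>For a root outside the subsystem, \<open>\<alpha>(X)\<close> is of order one and the gain alone has the required size.\<close>

lemma damp_off_wall:
  assumes "\<epsilon> \<le> a" "0 < \<epsilon>" "a \<le> 1" "0 \<le> b"
  shows "damp b \<le> damp (a * b) / \<epsilon>"
proof -
  have "\<epsilon> * (a * b) \<le> 1 * (a * b)"
    using assms by (intro mult_right_mono) auto
  then have "\<epsilon> * (1 + a * b) \<le> a * (1 + b)"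
    using assms(1) by (simp only: distrib_left mult_1_left mult_1_right)
  then have "b * (\<epsilon> * (1 + a * b)) \<le> b * (a * (1 + b))"
    using assms(4) by (rule mult_left_mono)
  moreover have "0 < 1 + b" using assms(4) by simp
  ultimately have "b / (1 + b) * (\<epsilon> * (1 + a * b)) \<le> a * b"
    by (simp add: pos_divide_le_eq mult_ac)
  moreover have "0 < \<epsilon> * (1 + a * b)"
    using assms by (intro mult_pos_pos add_pos_nonneg) auto
  ultimately have "b / (1 + b) \<le> a * b / (\<epsilon> * (1 + a * b))"
    by (simp only: pos_le_divide_eq)
  then show ?thesis by (simp add: damp_def mult.commute)
qed

lemma min_1_le_damp:
  assumes "0 \<le> b"
  shows "min 1 b \<le> 2 * damp b"
proof (cases "b \<le> 1")
  case True
  then have "b * b \<le> b * 1" using assms by (intro mult_left_mono) auto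
  then show ?thesis using True assms by (simp add: damp_def field_simps)
qed (simp add: damp_def field_simps)

text \<open>The heart of the proof. Let \<open>\<Psi>\<close> consist of the roots that are small at \<open>X\<close>; it is a proper subsystem
because some root has absolute value \<open>1\<close> there. The gain from the zeros bounds the alternant at \<open>L\<close>
by its values at \<open>L + z \<eta>\<close> with \<open>|z| = 2\<close>. These are signed sums of alternants of \<open>\<Psi>\<close>, which the induction
hypothesis controls. The factors for the roots in \<open>\<Psi>\<close> come from the induction hypothesis
together with the gain, those for the other roots from the gain only.\<close>

lemma alternant_induction_step:
  fixes \<Phi> P :: "'a::euclidean_space set"
  assumes rs: "reduced_root_system \<Phi>" "positive_system \<Phi> P"
    and IH: "\<And>\<Psi> R. \<Psi> \<subset> \<Phi> \<Longrightarrow> reduced_root_system \<Psi> \<Longrightarrow> \<exists>C>0. alternant_bounded \<Psi> (P \<inter> \<Psi>) R C"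
  shows "\<exists>C>0. \<forall>L X. (\<forall>w\<in>weyl_group \<Phi>. \<bar>Im (bpair (cmap w L) X)\<bar> \<le> R) \<longrightarrow>
     (\<forall>\<alpha>\<in>\<Phi>. cmod (cpair \<alpha> X) \<le> 1) \<longrightarrow> (\<exists>\<alpha>\<in>\<Phi>. cmod (cpair \<alpha> X) = 1) \<longrightarrow>
     cmod (calternant \<Phi> L X) \<le>
       C * (\<Sum>w\<in>weyl_group \<Phi>. \<Prod>\<alpha>\<in>P. damp (cmod (cpair \<alpha> X) * cmod (cpair \<alpha> (cmap w L))))"
proof -
  note P = positive_system_choice[OF rs]
  let ?W = "weyl_group \<Phi>"
  have fin: "finite \<Phi>" using rs(1) by (simp add: reduced_root_system_def)
  have finW: "finite ?W" using rs(1) by (rule finite_weyl_group)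
  obtain D where D: "D \<ge> 0" "\<And>L. (\<forall>\<alpha>\<in>\<Phi>. cpair \<alpha> L \<noteq> 0) \<Longrightarrow>
    (\<exists>\<eta>. transverse \<Phi> D \<eta> \<and> (\<forall>\<alpha>\<in>\<Phi>. \<bar>\<alpha> \<bullet> \<eta>\<bar> \<ge> 1) \<and>
      (\<forall>\<alpha>\<in>P. \<forall>\<beta>\<in>P. \<alpha> \<noteq> \<beta> \<longrightarrow>
        cpair \<alpha> L * of_real (\<beta> \<bullet> \<eta>) \<noteq> cpair \<beta> L * of_real (\<alpha> \<bullet> \<eta>)))"
    using exists_transverse[OF rs] by blast
  \<comment> \<open>there are finitely many subsystems, so the constants of the induction hypothesis are bounded\<close>
  let ?sub = "{\<Psi>. \<Psi> \<subset> \<Phi> \<and> reduced_root_system \<Psi>}"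
  have "\<forall>\<Psi>\<in>?sub. \<exists>C. C > 0 \<and> alternant_bounded \<Psi> (P \<inter> \<Psi>) (R + 2 * D) C"
    using IH by blast
  from bchoice[OF this] obtain CC where
    CC: "\<And>\<Psi>. \<Psi> \<in> ?sub \<Longrightarrow> CC \<Psi> > 0 \<and> alternant_bounded \<Psi> (P \<inter> \<Psi>) (R + 2 * D) (CC \<Psi>)"
    by blast
  define C0 where "C0 = (\<Sum>\<Psi>\<in>?sub. CC \<Psi>) + 1"
  have finsub: "finite ?sub"
    by (rule finite_subset[of _ "Pow \<Phi>"]) (use fin in auto)
  have C0: "CC \<Psi> \<le> C0" if "\<Psi> \<in> ?sub" for \<Psi>
    using member_le_sum[of \<Psi> ?sub CC] that finsub CC by (force simp: C0_def less_imp_le)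
  have C0pos: "C0 > 0"
    unfolding C0_def using CC by (intro add_nonneg_pos sum_nonneg) (auto simp: less_imp_le)
  define K where "K = (\<Sum>\<alpha>\<in>\<Phi>. \<Sum>\<beta>\<in>\<Phi>. \<bar>2 * (\<alpha> \<bullet> \<beta>) / (\<alpha> \<bullet> \<alpha>)\<bar>)"
  have K: "K \<ge> 0" by (simp add: K_def sum_nonneg)
  have K_le: "\<bar>2 * (\<alpha> \<bullet> \<beta>) / (\<alpha> \<bullet> \<alpha>)\<bar> \<le> K" if "\<alpha> \<in> \<Phi>" "\<beta> \<in> \<Phi>" for \<alpha> \<beta>
  proof -
    have "\<bar>2 * (\<alpha> \<bullet> \<beta>) / (\<alpha> \<bullet> \<alpha>)\<bar> \<le> (\<Sum>\<beta>\<in>\<Phi>. \<bar>2 * (\<alpha> \<bullet> \<beta>) / (\<alpha> \<bullet> \<alpha>)\<bar>)"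
      using that fin by (intro member_le_sum) auto
    also have "\<dots> \<le> K"
      unfolding K_def using that fin
      by (intro member_le_sum[where f = "\<lambda>\<alpha>. \<Sum>\<beta>\<in>\<Phi>. \<bar>2 * (\<alpha> \<bullet> \<beta>) / (\<alpha> \<bullet> \<alpha>)\<bar>"] sum_nonneg) auto
    finally show ?thesis .
  qed
  define \<epsilon> where "\<epsilon> = (1 / (K + 2)) ^ (card \<Phi> + 2)"
  have \<epsilon>: "\<epsilon> > 0" "\<epsilon> \<le> 1"
    unfolding \<epsilon>_def using K by (auto intro: power_le_one simp del: power_Suc power_Suc2)
  define B where "B = 2 * (1 + 2 * D) / \<epsilon>"
  have "2 * (1 + 2 * D) * \<epsilon> \<le> 2 * (1 + 2 * D) * 1"
    using D(1) \<epsilon> by (intro mult_left_mono) auto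
  then have B: "B > 0" "2 * (1 + 2 * D) \<le> B" "2 / \<epsilon> \<le> B"
    using D(1) \<epsilon> by (auto simp: B_def pos_le_divide_eq intro!: divide_right_mono divide_pos_pos)
  define C where "C = real (card ?W) * C0 * B ^ card P"
  have "card ?W > 0" using finW weyl_group.one card_gt_0_iff by blast
  then have Cpos: "C > 0" using C0pos B(1) by (simp add: C_def)
  show ?thesis
  proof (intro exI[of _ C] conjI allI impI Cpos)
    fix L X
    assume Im: "\<forall>w\<in>?W. \<bar>Im (bpair (cmap w L) X)\<bar> \<le> R"
      and X: "\<forall>\<alpha>\<in>\<Phi>. cmod (cpair \<alpha> X) \<le> 1" "\<exists>\<alpha>\<in>\<Phi>. cmod (cpair \<alpha> X) = 1"
    define S where "S = (\<Sum>w\<in>?W. \<Prod>\<alpha>\<in>P. damp (cmod (cpair \<alpha> X) * cmod (cpair \<alpha> (cmap w L))))"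
    have Snn: "S \<ge> 0" by (simp add: S_def sum_nonneg prod_nonneg damp_nonneg)
    show "cmod (calternant \<Phi> L X) \<le> C * S"
    proof (cases "\<forall>\<alpha>\<in>\<Phi>. cpair \<alpha> L \<noteq> 0")
      case False
      then have "calternant \<Phi> L X = 0" using calternant_eq_0_left[OF rs(1)] by blast
      then show ?thesis using Cpos Snn by simp
    next
      case True
      then obtain \<eta> where \<eta>: "transverse \<Phi> D \<eta>" "\<And>\<alpha>. \<alpha> \<in> \<Phi> \<Longrightarrow> \<bar>\<alpha> \<bullet> \<eta>\<bar> \<ge> 1"
        "\<And>\<alpha> \<beta>. \<alpha> \<in> P \<Longrightarrow> \<beta> \<in> P \<Longrightarrow> \<alpha> \<noteq> \<beta> \<Longrightarrow>
          cpair \<alpha> L * of_real (\<beta> \<bullet> \<eta>) \<noteq> cpair \<beta> L * of_real (\<alpha> \<bullet> \<eta>)"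
        using D(2) by blast
      have "\<exists>\<tau>. (1 / (K + 2)) ^ (card \<Phi> + 2) \<le> \<tau> \<and> \<tau> < 1 \<and>
          reduced_root_system {\<alpha>\<in>\<Phi>. cmod (cpair \<alpha> X) \<le> \<tau>}"
      proof (rule exists_reflection_closed_sublevel[OF rs(1) K])
        fix \<alpha> \<beta> assume ab: "\<alpha> \<in> \<Phi>" "\<beta> \<in> \<Phi>"
        have "cpair (root_reflection \<alpha> \<beta>) X = cpair \<beta> X - (2 * (\<alpha> \<bullet> \<beta>) / (\<alpha> \<bullet> \<alpha>)) *\<^sub>R cpair \<alpha> X"
          by (simp add: root_reflection_eq cpair_diff_left cpair_scaleR_left)
        then have "cmod (cpair (root_reflection \<alpha> \<beta>) X) \<le>
            cmod (cpair \<beta> X) + \<bar>2 * (\<alpha> \<bullet> \<beta>) / (\<alpha> \<bullet> \<alpha>)\<bar> * cmod (cpair \<alpha> X)"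
          using norm_triangle_ineq4 by (metis norm_scaleR)
        also have "\<dots> \<le> cmod (cpair \<beta> X) + K * cmod (cpair \<alpha> X)"
          using K_le[OF ab] by (intro add_left_mono mult_right_mono) auto
        finally show "cmod (cpair (root_reflection \<alpha> \<beta>) X) \<le> cmod (cpair \<beta> X) + K * cmod (cpair \<alpha> X)" .
      qed
      then obtain \<tau> where \<tau>: "\<epsilon> \<le> \<tau>" "\<tau> < 1" "reduced_root_system {\<alpha>\<in>\<Phi>. cmod (cpair \<alpha> X) \<le> \<tau>}"
        unfolding \<epsilon>_def by blast
      define \<Psi> where "\<Psi> = {\<alpha>\<in>\<Phi>. cmod (cpair \<alpha> X) \<le> \<tau>}"
      obtain \<alpha>0 where "\<alpha>0 \<in> \<Phi>" "cmod (cpair \<alpha>0 X) = 1" using X(2) by blast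
      then have "\<alpha>0 \<in> \<Phi> - \<Psi>" using \<tau>(2) by (simp add: \<Psi>_def)
      moreover have \<Psi>_sub: "\<Psi> \<subseteq> \<Phi>" by (auto simp: \<Psi>_def)
      ultimately have \<Psi>: "\<Psi> \<in> ?sub" "\<Psi> \<subseteq> \<Phi>" using \<tau>(3) unfolding \<Psi>_def[symmetric] by blast+
      let ?V = "weyl_group \<Psi>"
      have VW: "?V \<subseteq> ?W" using weyl_group_mono[OF \<Psi>(2)] by blast
      have finV: "finite ?V" using VW finW finite_subset by blast
      have cardV: "card ?V > 0" using finV weyl_group.one card_gt_0_iff by blast
      define a where "a \<alpha> = cmod (cpair \<alpha> X)" for \<alpha>
      define b where "b w \<alpha> = cmod (cpair \<alpha> (cmap w L))" for w \<alpha>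
      \<comment> \<open>bounds the factor of the induction hypothesis for the root \<open>\<alpha>\<close> at \<open>L + z \<eta>\<close>\<close>
      define h where "h w \<alpha> = (1 + 2 * D) * (a \<alpha> * (1 + b w \<alpha>) / (1 + a \<alpha> * b w \<alpha>))" for w \<alpha>
      have ab0: "a \<alpha> \<ge> 0" "b w \<alpha> \<ge> 0" for w \<alpha> by (auto simp: a_def b_def)
      have h0: "h w \<alpha> \<ge> 0" for w \<alpha> using ab0 D(1) by (simp add: h_def)
      define T where "T = (\<Sum>y\<in>?W. \<Prod>\<alpha>\<in>P \<inter> \<Psi>. h y \<alpha>)"
      have circle: "cmod (calternant \<Phi> (L + cscale z (\<eta>, 0)) X) \<le> real (card ?W) * C0 * T"
        if z: "cmod z = 2" for z
      proof -
        define Lz where "Lz = L + cscale z (\<eta>, 0)"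
        have cmapLz: "cmap w Lz = cmap w L + cscale z (w \<eta>, 0)" if "w \<in> ?W" for w
          using weyl_group_linear[OF that] by (simp add: Lz_def cmap_add cmap_cscale cmap_real)
        have ImLz: "\<bar>Im (bpair (cmap w Lz) X)\<bar> \<le> R + 2 * D" if w: "w \<in> ?W" for w
        proof -
          have "cmod (z * cpair (w \<eta>) X) \<le> 2 * D"
            unfolding norm_mult z using transverseD(2)[OF \<eta>(1) w X(1)] by simp
          then have "\<bar>Im (z * cpair (w \<eta>) X)\<bar> \<le> 2 * D"
            using abs_Im_le_cmod order_trans by blast
          moreover have "bpair (cmap w Lz) X = bpair (cmap w L) X + z * cpair (w \<eta>) X"
            by (simp add: cmapLz[OF w] bpair_add_left bpair_cscale_left bpair_real)
          ultimately show ?thesis using Im w by fastforce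
        qed
        have bLz: "damp (a \<alpha> * cmod (cpair \<alpha> (cmap w Lz))) \<le> h w \<alpha>"
          if w: "w \<in> ?W" and \<alpha>: "\<alpha> \<in> \<Phi>" for w \<alpha>
        proof -
          obtain v where v: "v \<in> ?W" "v \<circ> w = id" "w \<circ> v = id" using weyl_group_inverse[OF w] .
          have "\<bar>\<alpha> \<bullet> w \<eta>\<bar> = \<bar>v \<alpha> \<bullet> \<eta>\<bar>"
            using weyl_group_adjoint[OF v(1) v(3,2)] by simp
          also have "\<dots> \<le> D"
            by (rule transverseD(1)[OF \<eta>(1) weyl_group_roots[OF rs(1) v(1) \<alpha>]])
          finally have "cmod (z * cpair \<alpha> (w \<eta>, 0)) \<le> 2 * D"
            by (simp add: norm_mult z cpair_real)
          then have "cmod (cpair \<alpha> (cmap w Lz)) \<le> b w \<alpha> + 2 * D"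
            using norm_triangle_ineq[of "cpair \<alpha> (cmap w L)" "z * cpair \<alpha> (w \<eta>, 0)"]
            by (simp add: cmapLz[OF w] cpair_add_right cpair_cscale b_def)
          then show ?thesis
            unfolding h_def using ab0 D(1) X(1) \<alpha> by (intro damp_shift) (auto simp: a_def)
        qed
        have sub: "cmod (calternant \<Psi> (cmap w Lz) X) \<le> C0 * (real (card ?V) * T)" if w: "w \<in> ?W" for w
        proof -
          have "\<forall>u\<in>?V. \<bar>Im (bpair (cmap u (cmap w Lz)) X)\<bar> \<le> R + 2 * D"
            using ImLz w VW by (auto simp flip: cmap_comp intro: weyl_group_compose)
          then have "cmod (calternant \<Psi> (cmap w Lz) X) \<le> CC \<Psi> * (\<Sum>u\<in>?V. \<Prod>\<alpha>\<in>P \<inter> \<Psi>.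
              damp (cmod (cpair \<alpha> X) * cmod (cpair \<alpha> (cmap u (cmap w Lz)))))"
            using CC[OF \<Psi>(1)] unfolding alternant_bounded_def by blast
          also have "\<dots> \<le> C0 * (\<Sum>u\<in>?V. T)"
          proof (intro mult_mono sum_mono sum_nonneg prod_nonneg damp_nonneg)
            fix u assume u: "u \<in> ?V"
            then have uw: "u \<circ> w \<in> ?W" using VW w by (auto intro: weyl_group_compose)
            have "(\<Prod>\<alpha>\<in>P \<inter> \<Psi>. damp (cmod (cpair \<alpha> X) * cmod (cpair \<alpha> (cmap u (cmap w Lz)))))
                \<le> (\<Prod>\<alpha>\<in>P \<inter> \<Psi>. h (u \<circ> w) \<alpha>)"
              using bLz[OF uw] \<Psi>(2)
              by (intro prod_mono) (auto simp: a_def cmap_comp damp_nonneg simp del: comp_apply)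
            also have "\<dots> \<le> T"
              unfolding T_def
              by (rule member_le_sum[where f = "\<lambda>y. \<Prod>\<alpha>\<in>P \<inter> \<Psi>. h y \<alpha>"])
                (use uw finW h0 in \<open>auto simp: prod_nonneg\<close>)
            finally show "(\<Prod>\<alpha>\<in>P \<inter> \<Psi>. damp (cmod (cpair \<alpha> X) * cmod (cpair \<alpha> (cmap u (cmap w Lz))))) \<le> T" .
          qed (use C0[OF \<Psi>(1)] C0pos in auto)
          finally show ?thesis by simp
        qed
        have "real (card ?V) * cmod (calternant \<Phi> Lz X) =
            cmod (\<Sum>w\<in>?W. of_real (lin_det w) * calternant \<Psi> (cmap w Lz) X)"
          unfolding calternant_subsystem[OF rs(1) \<Psi>(2), symmetric] by (simp add: norm_mult)
        also have "\<dots> \<le> (\<Sum>w\<in>?W. C0 * (real (card ?V) * T))"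
          using sub by (intro order_trans[OF norm_sum] sum_mono)
            (simp add: norm_mult lin_det_weyl_group[OF rs(1)])
        finally have "real (card ?V) * cmod (calternant \<Phi> Lz X) \<le>
            real (card ?V) * (real (card ?W) * C0 * T)" by (simp add: mult_ac)
        then show ?thesis using cardV by (simp add: Lz_def)
      qed
      have "cmod (calternant \<Phi> L X) \<le>
          real (card ?W) * C0 * T * (\<Prod>\<alpha>\<in>P. min 1 (cmod (cpair \<alpha> L)))"
        by (rule calternant_gain[OF rs \<eta>(2,3) circle])
      also have "\<dots> = real (card ?W) * C0 *
          (\<Sum>y\<in>?W. (\<Prod>\<alpha>\<in>P \<inter> \<Psi>. h y \<alpha>) * (\<Prod>\<alpha>\<in>P. min 1 (cmod (cpair \<alpha> L))))"
        by (simp add: T_def sum_distrib_left sum_distrib_right mult_ac)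
      also have "\<dots> \<le> real (card ?W) * C0 * (\<Sum>y\<in>?W. B ^ card P * (\<Prod>\<alpha>\<in>P. damp (a \<alpha> * b y \<alpha>)))"
      proof (intro mult_left_mono sum_mono)
        fix y assume y: "y \<in> ?W"
        obtain v where v: "v \<in> ?W" "v \<circ> y = id" "y \<circ> v = id" using weyl_group_inverse[OF y] .
        \<comment> \<open>the gain is Weyl invariant, so it can be matched with the factors of the summand of \<open>y\<close>\<close>
        have "(\<Prod>\<alpha>\<in>P. min 1 (cmod (cpair \<alpha> L))) = (\<Prod>\<alpha>\<in>P. min 1 (cmod (cpair (v \<alpha>) L)))"
          using rs v(1) by (intro prod_positive_weyl_invariant[symmetric]) (auto simp: cpair_minus_left)
        also have "\<dots> \<le> (\<Prod>\<alpha>\<in>P. 2 * damp (b y \<alpha>))"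
          using min_1_le_damp by (intro prod_mono) (simp add: b_def cpair_cmap[OF y v(2,3)])
        finally have m: "(\<Prod>\<alpha>\<in>P. min 1 (cmod (cpair \<alpha> L))) \<le> (\<Prod>\<alpha>\<in>P. 2 * damp (b y \<alpha>))" .
        have "(\<Prod>\<alpha>\<in>P \<inter> \<Psi>. h y \<alpha>) * (\<Prod>\<alpha>\<in>P. min 1 (cmod (cpair \<alpha> L)))
            \<le> (\<Prod>\<alpha>\<in>P \<inter> \<Psi>. h y \<alpha>) * (\<Prod>\<alpha>\<in>P. 2 * damp (b y \<alpha>))"
          by (intro mult_left_mono m prod_nonneg) (use h0 in auto)
        also have "\<dots> = (\<Prod>\<alpha>\<in>P. (if \<alpha> \<in> \<Psi> then h y \<alpha> else 1) * (2 * damp (b y \<alpha>)))"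
          using P(2) by (simp add: prod.inter_restrict prod.distrib)
        also have "\<dots> \<le> (\<Prod>\<alpha>\<in>P. B * damp (a \<alpha> * b y \<alpha>))"
        proof (intro prod_mono conjI)
          fix \<alpha> assume \<alpha>: "\<alpha> \<in> P"
          have d0: "damp (b y \<alpha>) \<ge> 0" "damp (a \<alpha> * b y \<alpha>) \<ge> 0" using ab0 by (auto intro: damp_nonneg)
          show "0 \<le> (if \<alpha> \<in> \<Psi> then h y \<alpha> else 1) * (2 * damp (b y \<alpha>))"
            using h0 d0 by auto
          show "(if \<alpha> \<in> \<Psi> then h y \<alpha> else 1) * (2 * damp (b y \<alpha>)) \<le> B * damp (a \<alpha> * b y \<alpha>)"
          proof (cases "\<alpha> \<in> \<Psi>")
            case True
            have "h y \<alpha> * (2 * damp (b y \<alpha>)) =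
                2 * (1 + 2 * D) * (damp (b y \<alpha>) * (a \<alpha> * (1 + b y \<alpha>) / (1 + a \<alpha> * b y \<alpha>)))"
              by (simp add: h_def)
            also have "\<dots> \<le> B * damp (a \<alpha> * b y \<alpha>)"
              unfolding damp_near_wall[OF ab0] using B(2) d0 by (intro mult_right_mono) auto
            finally show ?thesis using True by simp
          next
            case False
            then have "damp (b y \<alpha>) \<le> damp (a \<alpha> * b y \<alpha>) / \<epsilon>"
              using \<alpha> P(1) \<tau>(1) X(1) \<epsilon> ab0 by (intro damp_off_wall) (auto simp: \<Psi>_def a_def)
            then have "2 * damp (b y \<alpha>) \<le> (2 / \<epsilon>) * damp (a \<alpha> * b y \<alpha>)" by simp
            also have "\<dots> \<le> B * damp (a \<alpha> * b y \<alpha>)" using B(3) d0 by (intro mult_right_mono) auto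
            finally show ?thesis using False by simp
          qed
        qed
        finally show "(\<Prod>\<alpha>\<in>P \<inter> \<Psi>. h y \<alpha>) * (\<Prod>\<alpha>\<in>P. min 1 (cmod (cpair \<alpha> L)))
            \<le> B ^ card P * (\<Prod>\<alpha>\<in>P. damp (a \<alpha> * b y \<alpha>))"
          by (simp add: prod.distrib)
      qed (use C0pos in auto)
      also have "\<dots> = C * S"
        by (simp add: C_def S_def a_def b_def sum_distrib_left mult_ac)
      finally show ?thesis .
    qed
  qed
qed

text \<open>Induction on the number of roots. Scaling invariance reduces to the case that the largest \<open>|\<alpha>(X)|\<close>
is \<open>1\<close>, unless all of them vanish, and then so does the alternant.\<close>

theorem alternant_estimate:
  fixes \<Phi> P :: "'a::euclidean_space set"
  assumes "reduced_root_system \<Phi>" "positive_system \<Phi> P"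
  shows "\<exists>C>0. alternant_bounded \<Phi> P R C"
  using assms
proof (induction "card \<Phi>" arbitrary: \<Phi> P R rule: less_induct)
  case less
  note rs = less.prems
  note P = positive_system_choice[OF rs]
  have fin: "finite \<Phi>" using rs(1) by (simp add: reduced_root_system_def)
  show ?case
  proof (cases "\<Phi> = {}")
    case True
    then have "P = {}" using P(1) by simp
    have "cmod (calternant {} L X) \<le> exp R" if "\<bar>Im (bpair (cmap id L) X)\<bar> \<le> R" for L X :: "'a \<times> 'a"
      using that by (simp add: calternant_def weyl_group_empty lin_det_id norm_exp_eq_Re)
    then have "alternant_bounded \<Phi> P R (exp R)"
      unfolding alternant_bounded_def True \<open>P = {}\<close> by (simp add: weyl_group_empty)
    then show ?thesis using exp_gt_zero by blast
  next
    case False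
    have "\<exists>C>0. alternant_bounded \<Psi> (P \<inter> \<Psi>) R' C" if "\<Psi> \<subset> \<Phi>" "reduced_root_system \<Psi>" for \<Psi> R'
    proof (rule less.hyps)
      show "card \<Psi> < card \<Phi>" using fin that(1) by (rule psubset_card_mono)
      show "positive_system \<Psi> (P \<inter> \<Psi>)" using rs(2) that(1) by (intro positive_system_subset) auto
    qed (rule that(2))
    then have "\<exists>C>0. \<forall>L X. (\<forall>w\<in>weyl_group \<Phi>. \<bar>Im (bpair (cmap w L) X)\<bar> \<le> R) \<longrightarrow>
        (\<forall>\<alpha>\<in>\<Phi>. cmod (cpair \<alpha> X) \<le> 1) \<longrightarrow> (\<exists>\<alpha>\<in>\<Phi>. cmod (cpair \<alpha> X) = 1) \<longrightarrow>
        cmod (calternant \<Phi> L X) \<le>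
          C * (\<Sum>w\<in>weyl_group \<Phi>. \<Prod>\<alpha>\<in>P. damp (cmod (cpair \<alpha> X) * cmod (cpair \<alpha> (cmap w L))))"
      by (rule alternant_induction_step[OF rs])
    then obtain C where C: "C > 0" and
      bound: "\<forall>L X. (\<forall>w\<in>weyl_group \<Phi>. \<bar>Im (bpair (cmap w L) X)\<bar> \<le> R) \<longrightarrow>
        (\<forall>\<alpha>\<in>\<Phi>. cmod (cpair \<alpha> X) \<le> 1) \<longrightarrow> (\<exists>\<alpha>\<in>\<Phi>. cmod (cpair \<alpha> X) = 1) \<longrightarrow>
        cmod (calternant \<Phi> L X) \<le>
          C * (\<Sum>w\<in>weyl_group \<Phi>. \<Prod>\<alpha>\<in>P. damp (cmod (cpair \<alpha> X) * cmod (cpair \<alpha> (cmap w L))))"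
      by (elim exE conjE) (rule that)
    have "alternant_bounded \<Phi> P R C"
      unfolding alternant_bounded_def
    proof (intro allI impI)
      fix L X assume Im: "\<forall>w\<in>weyl_group \<Phi>. \<bar>Im (bpair (cmap w L) X)\<bar> \<le> R"
      let ?S = "\<lambda>L X. \<Sum>w\<in>weyl_group \<Phi>. \<Prod>\<alpha>\<in>P. damp (cmod (cpair \<alpha> X) * cmod (cpair \<alpha> (cmap w L)))"
      define m where "m = Max ((\<lambda>\<alpha>. cmod (cpair \<alpha> X)) ` \<Phi>)"
      have le: "cmod (cpair \<alpha> X) \<le> m" if "\<alpha> \<in> \<Phi>" for \<alpha>
        unfolding m_def using that fin by simp
      have "m \<in> (\<lambda>\<alpha>. cmod (cpair \<alpha> X)) ` \<Phi>"
        unfolding m_def using fin False by (intro Max_in) auto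
      then obtain \<alpha>0 where \<alpha>0: "\<alpha>0 \<in> \<Phi>" "m = cmod (cpair \<alpha>0 X)" by blast
      show "cmod (calternant \<Phi> L X) \<le> C * ?S L X"
      proof (cases "m = 0")
        case True
        then have "calternant \<Phi> L X = 0" using calternant_eq_0_right[OF rs(1) \<alpha>0(1)] \<alpha>0(2) by simp
        then show ?thesis using C by (simp add: sum_nonneg prod_nonneg damp_nonneg)
      next
        case False
        then have m: "m > 0" using \<alpha>0(2) by simp
        let ?L = "m *\<^sub>R L" and ?X = "(1 / m) *\<^sub>R X"
        have inv: "bpair (cmap w ?L) ?X = bpair (cmap w L) X"
          "cmod (cpair \<alpha> ?X) * cmod (cpair \<alpha> (cmap w ?L)) = cmod (cpair \<alpha> X) * cmod (cpair \<alpha> (cmap w L))"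
          if "w \<in> weyl_group \<Phi>" for w \<alpha>
          using m weyl_group_linear[OF that]
          by (simp_all add: cmap_scaleR bpair_scaleR_left bpair_scaleR_right cpair_scaleR_right)
        have eq: "calternant \<Phi> ?L ?X = calternant \<Phi> L X" "?S ?L ?X = ?S L X"
          unfolding calternant_def by (intro sum.cong prod.cong refl; simp only: inv)+
        have "cmod (calternant \<Phi> ?L ?X) \<le> C * ?S ?L ?X"
        proof (rule bound[THEN spec, THEN spec, THEN mp, THEN mp, THEN mp])
          show "\<forall>\<alpha>\<in>\<Phi>. cmod (cpair \<alpha> ?X) \<le> 1"
            using le m by (simp add: cpair_scaleR_right field_simps)
          show "\<exists>\<alpha>\<in>\<Phi>. cmod (cpair \<alpha> ?X) = 1"
            using \<alpha>0 m by (intro bexI[of _ \<alpha>0]) (auto simp: cpair_scaleR_right)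
        qed (use Im inv in simp)
        then show ?thesis unfolding eq .
      qed
    qed
    then show ?thesis using C by blast
  qed
qed

section \<open>The quotient and its derivatives\<close>

lemma holo_calternant: "holo (calternant \<Phi> (l, 0))"
proof -
  have "calternant \<Phi> (l, 0) =
      (\<lambda>X. \<Sum>w\<in>weyl_group \<Phi>. of_real (lin_det w) * exp (\<i> * cpair (w l) X))"
    by (auto simp: calternant_def fun_eq_iff cmap_real weyl_group_linear bpair_real intro!: sum.cong)
  then show ?thesis by (simp add: holo_sum holo_exponential)
qed

text \<open>The holomorphic quotient restricts to a smooth function on the real space, and smooth extensions
are unique because the regular points are dense. Hence its restriction is the quotient defined by a
definite description.\<close>

lemma exists_holo_quotient:
  fixes \<Phi> P :: "'a::euclidean_space set"
  assumes rs: "reduced_root_system \<Phi>" "positive_system \<Phi> P"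
  obtains E where "holo E" "\<And>X. calternant \<Phi> (l, 0) X = (\<Prod>\<alpha>\<in>P. cpair \<alpha> X) * E X"
    "weyl_quotient \<Phi> P l = (\<lambda>x. E (x, 0))"
proof -
  note P = positive_system_choice[OF rs]
  have "\<exists>E. holo E \<and> (\<forall>X. calternant \<Phi> (l, 0) X = (\<Prod>\<alpha>\<in>P. cpair \<alpha> X) * E X)"
    by (rule holo_divide_roots[OF P(2) holo_calternant])
      (use P(1) root_nonzero[OF rs(1)] positive_not_proportional[OF rs]
        calternant_eq_0_right[OF rs(1)] in blast)+
  then obtain E where E: "holo E" "\<And>X. calternant \<Phi> (l, 0) X = (\<Prod>\<alpha>\<in>P. cpair \<alpha> X) * E X" by blast
  obtain v where v: "\<And>\<alpha>. \<alpha> \<in> P \<Longrightarrow> \<alpha> \<bullet> v \<noteq> 0"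
    using rs(2) P(1) unfolding positive_system_def by blast
  have prod: "(\<Prod>\<alpha>\<in>P. cpair \<alpha> (x, 0)) = of_real (root_product P x)" for x
    by (simp add: root_product_def cpair_real)
  have quot: "E (x, 0) = weyl_alternant \<Phi> l x / of_real (root_product P x)"
    if "root_product P x \<noteq> 0" for x
    using E(2)[of "(x, 0)"] that by (simp add: prod calternant_real)
  have "weyl_quotient \<Phi> P l = (\<lambda>x. E (x, 0))"
    unfolding weyl_quotient_def
  proof (rule the_equality)
    show "smooth (\<lambda>x. E (x, 0)) \<and> (\<forall>X. root_product P X \<noteq> 0 \<longrightarrow>
        E (X, 0) = weyl_alternant \<Phi> l X / of_real (root_product P X))"
      using smooth_holo[OF E(1)] quot by blast
    fix F assume F: "smooth F \<and> (\<forall>X. root_product P X \<noteq> 0 \<longrightarrow>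
        F X = weyl_alternant \<Phi> l X / of_real (root_product P X))"
    show "F = (\<lambda>x. E (x, 0))"
    proof
      fix x
      have "C_k 0 F" using F unfolding smooth_def by blast
      then have "continuous_on UNIV F" by simp
      then have "continuous_on UNIV (\<lambda>t::real. F (x + t *\<^sub>R v))"
        by (rule continuous_on_compose2) (auto intro!: continuous_intros)
      then have "isCont (\<lambda>t::real. F (x + t *\<^sub>R v)) 0"
        by (simp add: continuous_on_eq_continuous_at)
      then have lim: "((\<lambda>t. F (x + t *\<^sub>R v)) \<longlongrightarrow> F x) (at 0)" by (simp add: isCont_def)
      have "\<forall>\<^sub>F t in at (0::real). F (x + t *\<^sub>R v) = E ((x, 0) + t *\<^sub>R (v, 0))"
        using eventually_regular_line[OF P(2) v, of "(x, 0)"]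
      proof (rule eventually_mono)
        fix t :: real assume "\<forall>\<alpha>\<in>P. cpair \<alpha> ((x, 0) + t *\<^sub>R (v, 0)) \<noteq> 0"
        then have "root_product P (x + t *\<^sub>R v) \<noteq> 0"
          using P(2) by (simp add: root_product_def cpair_real)
        then show "F (x + t *\<^sub>R v) = E ((x, 0) + t *\<^sub>R (v, 0))"
          using F quot by simp
      qed
      then have "((\<lambda>t. F (x + t *\<^sub>R v)) \<longlongrightarrow> E (x, 0)) (at 0)"
        using holo_tendsto_line[OF E(1), of "(x, 0)" "(v, 0)"] tendsto_cong by fast
      then show "F x = E (x, 0)"
        using lim tendsto_unique[OF trivial_limit_at] by blast
    qed
  qed
  then show ?thesis using that E by blast
qed

text \<open>Passing from a root to its coroot and from a nearby complex point, where \<open>\<alpha>\<close> has absolute value \<open>a'\<close>, to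
the real point, where it has absolute value \<open>a\<close>, costs only a constant.\<close>

lemma factor_comparison:
  fixes \<alpha> y :: "'a::euclidean_space"
  assumes "\<alpha> \<noteq> 0" "0 \<le> a" "0 \<le> a'" "0 \<le> n" "a * \<bar>y \<bullet> \<alpha>\<bar> \<le> a' * \<bar>y \<bullet> \<alpha>\<bar> + (\<alpha> \<bullet> \<alpha>) * n"
  shows "\<bar>y \<bullet> \<alpha>\<bar> / (1 + a' * \<bar>y \<bullet> \<alpha>\<bar>) \<le>
    (2 * n + 1) * (1 + \<alpha> \<bullet> \<alpha>) * (\<bar>y \<bullet> coroot \<alpha>\<bar> / (1 + a * \<bar>y \<bullet> coroot \<alpha>\<bar>))"
proof -
  define p where "p = \<alpha> \<bullet> \<alpha>"
  define b where "b = \<bar>y \<bullet> \<alpha>\<bar>"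
  have p: "p > 0" using assms(1) by (simp add: p_def)
  have b: "b \<ge> 0" by (simp add: b_def)
  have s: "\<bar>y \<bullet> coroot \<alpha>\<bar> = 2 * b / p"
    using p by (simp add: coroot_def b_def p_def abs_mult)
  have nn: "0 \<le> a' * b" "0 \<le> a * b" "0 \<le> n * p" "0 \<le> n * (a' * b)" "0 \<le> n * p * (a' * b)" "0 \<le> p * (a' * b)"
    using assms b p by auto
  have "p + 2 * (a * b) \<le> p + 2 * (a' * b) + 2 * (p * n)"
    using assms(5) by (simp add: p_def b_def)
  also have "\<dots> \<le> 2 * ((2 * n + 1) * (1 + p)) * (1 + a' * b)"
    using nn p assms(4) by (simp add: algebra_simps)
  finally have key: "p + 2 * (a * b) \<le> 2 * ((2 * n + 1) * (1 + p)) * (1 + a' * b)" .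
  have den: "0 < 1 + a' * b" "0 < p + 2 * (a * b)" using nn p by auto
  have "b / (1 + a' * b) = b * (p + 2 * (a * b)) / ((1 + a' * b) * (p + 2 * (a * b)))"
    using den by simp
  also have "\<dots> \<le> b * (2 * ((2 * n + 1) * (1 + p)) * (1 + a' * b)) / ((1 + a' * b) * (p + 2 * (a * b)))"
    using key b den by (intro divide_right_mono mult_left_mono) auto
  also have "\<dots> = (2 * n + 1) * (1 + p) * (2 * b / (p + 2 * (a * b)))"
    using den by simp
  also have "2 * b / (p + 2 * (a * b)) = (2 * b / p) / (1 + a * (2 * b / p))"
    using p den by (simp add: field_simps)
  finally show ?thesis by (simp add: s b_def p_def)
qed

text \<open>Dividing the estimate for the alternant by the product of the roots. The distance from the real
point \<open>x\<close> is limited to \<open>n / \<parallel>l\<parallel>\<close>, which keeps the exponentials bounded and changes the right hand side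
by a constant factor only.\<close>

lemma quotient_estimate_regular:
  fixes \<Phi> P :: "'a::euclidean_space set"
  assumes rs: "reduced_root_system \<Phi>" "positive_system \<Phi> P"
    and C: "alternant_bounded \<Phi> P n C" "C > 0"
    and E: "calternant \<Phi> (l, 0) ((x, 0) + Y) = (\<Prod>\<alpha>\<in>P. cpair \<alpha> ((x, 0) + Y)) * e"
    and Y: "norm l * norm Y \<le> n" and reg: "\<forall>\<alpha>\<in>P. cpair \<alpha> ((x, 0) + Y) \<noteq> 0"
  shows "cmod e \<le> C * (\<Prod>\<alpha>\<in>P. (2 * n + 1) * (1 + \<alpha> \<bullet> \<alpha>)) *
    (\<Sum>w\<in>weyl_group \<Phi>. \<Prod>\<alpha>\<in>P. \<bar>w l \<bullet> coroot \<alpha>\<bar> / (1 + \<bar>\<alpha> \<bullet> x\<bar> * \<bar>w l \<bullet> coroot \<alpha>\<bar>))"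
proof -
  note P = positive_system_choice[OF rs]
  let ?Z = "(x, 0) + Y"
  let ?W = "weyl_group \<Phi>"
  have n: "n \<ge> 0" using Y by (meson mult_nonneg_nonneg norm_ge_zero order_trans)
  have cmap: "cmap w (l, 0) = (w l, 0)" if "w \<in> ?W" for w
    using that by (simp add: cmap_real weyl_group_linear)
  have "\<bar>Im (bpair (cmap w (l, 0)) ?Z)\<bar> \<le> n" if w: "w \<in> ?W" for w
  proof -
    have "Im (bpair (cmap w (l, 0)) ?Z) = Im (cpair (w l) Y)"
      using cmap[OF w] by (simp add: bpair_real cpair_add_right cpair_real)
    also have "\<bar>\<dots>\<bar> \<le> norm (w l) * norm Y"
      using abs_Im_le_cmod norm_cpair_le order_trans by blast
    finally show ?thesis using Y weyl_group_norm[OF w] by simp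
  qed
  then have "cmod (calternant \<Phi> (l, 0) ?Z) \<le>
      C * (\<Sum>w\<in>?W. \<Prod>\<alpha>\<in>P. damp (cmod (cpair \<alpha> ?Z) * cmod (cpair \<alpha> (cmap w (l, 0)))))"
    using C(1) unfolding alternant_bounded_def by blast
  also have "\<dots> = C * (\<Sum>w\<in>?W. (\<Prod>\<alpha>\<in>P. cmod (cpair \<alpha> ?Z)) *
      (\<Prod>\<alpha>\<in>P. \<bar>w l \<bullet> \<alpha>\<bar> / (1 + cmod (cpair \<alpha> ?Z) * \<bar>w l \<bullet> \<alpha>\<bar>)))"
    by (simp add: cmap cpair_real damp_def inner_commute flip: prod.distrib cong: sum.cong)
  finally have "(\<Prod>\<alpha>\<in>P. cmod (cpair \<alpha> ?Z)) * cmod e \<le> (\<Prod>\<alpha>\<in>P. cmod (cpair \<alpha> ?Z)) *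
      (C * (\<Sum>w\<in>?W. \<Prod>\<alpha>\<in>P. \<bar>w l \<bullet> \<alpha>\<bar> / (1 + cmod (cpair \<alpha> ?Z) * \<bar>w l \<bullet> \<alpha>\<bar>)))"
    by (simp add: E norm_mult prod_norm sum_distrib_left mult_ac)
  moreover have "(\<Prod>\<alpha>\<in>P. cmod (cpair \<alpha> ?Z)) > 0" using reg by (intro prod_pos) auto
  ultimately have "cmod e \<le>
      C * (\<Sum>w\<in>?W. \<Prod>\<alpha>\<in>P. \<bar>w l \<bullet> \<alpha>\<bar> / (1 + cmod (cpair \<alpha> ?Z) * \<bar>w l \<bullet> \<alpha>\<bar>))"
    by (rule mult_left_le_imp_le)
  also have "\<dots> \<le> C * (\<Sum>w\<in>?W. \<Prod>\<alpha>\<in>P. (2 * n + 1) * (1 + \<alpha> \<bullet> \<alpha>) *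
      (\<bar>w l \<bullet> coroot \<alpha>\<bar> / (1 + \<bar>\<alpha> \<bullet> x\<bar> * \<bar>w l \<bullet> coroot \<alpha>\<bar>)))"
  proof (intro mult_left_mono sum_mono prod_mono conjI)
    fix w \<alpha> assume w: "w \<in> ?W" and \<alpha>: "\<alpha> \<in> P"
    have "\<bar>\<alpha> \<bullet> x\<bar> = cmod (cpair \<alpha> ?Z - cpair \<alpha> Y)"
      by (simp add: cpair_add_right cpair_real)
    also have "\<dots> \<le> cmod (cpair \<alpha> ?Z) + norm \<alpha> * norm Y"
      using norm_triangle_ineq4[of "cpair \<alpha> ?Z" "cpair \<alpha> Y"] norm_cpair_le[of \<alpha> Y] by linarith
    finally have "\<bar>\<alpha> \<bullet> x\<bar> * \<bar>w l \<bullet> \<alpha>\<bar> \<le> (cmod (cpair \<alpha> ?Z) + norm \<alpha> * norm Y) * \<bar>w l \<bullet> \<alpha>\<bar>"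
      by (intro mult_right_mono) auto
    also have "\<dots> \<le> cmod (cpair \<alpha> ?Z) * \<bar>w l \<bullet> \<alpha>\<bar> + norm \<alpha> * norm Y * (norm l * norm \<alpha>)"
      using Cauchy_Schwarz_ineq2[of "w l" \<alpha>] weyl_group_norm[OF w, of l]
      by (simp add: distrib_right mult_left_mono)
    also have "norm \<alpha> * norm Y * (norm l * norm \<alpha>) = (\<alpha> \<bullet> \<alpha>) * (norm l * norm Y)"
      by (simp add: power2_norm_eq_inner[symmetric] power2_eq_square)
    also have "\<dots> \<le> (\<alpha> \<bullet> \<alpha>) * n" using Y by (intro mult_left_mono) auto
    finally show "\<bar>w l \<bullet> \<alpha>\<bar> / (1 + cmod (cpair \<alpha> ?Z) * \<bar>w l \<bullet> \<alpha>\<bar>) \<le> (2 * n + 1) * (1 + \<alpha> \<bullet> \<alpha>) *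
        (\<bar>w l \<bullet> coroot \<alpha>\<bar> / (1 + \<bar>\<alpha> \<bullet> x\<bar> * \<bar>w l \<bullet> coroot \<alpha>\<bar>))"
      using n root_nonzero[OF rs(1)] \<alpha> P(1) by (intro factor_comparison) auto
  qed (use C(2) in auto)
  also have "\<dots> = C * (\<Prod>\<alpha>\<in>P. (2 * n + 1) * (1 + \<alpha> \<bullet> \<alpha>)) *
    (\<Sum>w\<in>?W. \<Prod>\<alpha>\<in>P. \<bar>w l \<bullet> coroot \<alpha>\<bar> / (1 + \<bar>\<alpha> \<bullet> x\<bar> * \<bar>w l \<bullet> coroot \<alpha>\<bar>))"
    unfolding prod.distrib[of "\<lambda>\<alpha>. (2 * n + 1) * (1 + \<alpha> \<bullet> \<alpha>)"] by (simp only: sum_distrib_left mult.assoc)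
  finally show ?thesis .
qed

theorem theorem1p2:
  fixes \<Phi> P :: "'a::euclidean_space set" and k :: nat
  assumes "reduced_root_system \<Phi>"
    and "positive_system \<Phi> P"
  shows "\<exists>C::real. C > 0 \<and>
    (\<forall>(l::'a) (X::'a) (\<xi>s::'a list). length \<xi>s = k \<and> (\<forall>\<xi>\<in>set \<xi>s. norm \<xi> = 1) \<longrightarrow>
      cmod (foldr dir_deriv \<xi>s (weyl_quotient \<Phi> P l) X)
        \<le> C * norm l ^ k *
          (\<Sum>w\<in>weyl_group \<Phi>. \<Prod>\<alpha>\<in>P.
             \<bar>w l \<bullet> coroot \<alpha>\<bar> / (1 + \<bar>\<alpha> \<bullet> X\<bar> * \<bar>w l \<bullet> coroot \<alpha>\<bar>)))"
proof -
  note P = positive_system_choice[OF assms]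
  define n where "n = real k + 1"
  obtain C0 where C0: "C0 > 0" "alternant_bounded \<Phi> P n C0"
    using alternant_estimate[OF assms] by blast
  define C where "C = C0 * (\<Prod>\<alpha>\<in>P. (2 * n + 1) * (1 + \<alpha> \<bullet> \<alpha>))"
  have "(\<Prod>\<alpha>\<in>P. (2 * n + 1) * (1 + \<alpha> \<bullet> \<alpha>)) > 0"
    by (intro prod_pos) (auto simp: n_def add_pos_nonneg intro!: mult_pos_pos)
  then have Cpos: "C > 0" using C0 by (simp add: C_def)
  obtain v where v: "\<And>\<alpha>. \<alpha> \<in> P \<Longrightarrow> \<alpha> \<bullet> v \<noteq> 0"
    using assms(2) P(1) unfolding positive_system_def by blast
  show ?thesis
  proof (intro exI[of _ C] conjI allI impI Cpos)
    fix l x :: 'a and \<xi>s :: "'a list"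
    assume "length \<xi>s = k \<and> (\<forall>\<xi>\<in>set \<xi>s. norm \<xi> = 1)"
    then have \<xi>s: "length \<xi>s = k" "\<And>\<xi>. \<xi> \<in> set \<xi>s \<Longrightarrow> norm \<xi> = 1" by auto
    define S where "S = (\<Sum>w\<in>weyl_group \<Phi>. \<Prod>\<alpha>\<in>P.
             \<bar>w l \<bullet> coroot \<alpha>\<bar> / (1 + \<bar>\<alpha> \<bullet> x\<bar> * \<bar>w l \<bullet> coroot \<alpha>\<bar>))"
    have S: "S \<ge> 0" unfolding S_def by (intro sum_nonneg prod_nonneg) auto
    obtain E where E: "holo E" "\<And>X. calternant \<Phi> (l, 0) X = (\<Prod>\<alpha>\<in>P. cpair \<alpha> X) * E X"
      "weyl_quotient \<Phi> P l = (\<lambda>x. E (x, 0))"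
      by (rule exists_holo_quotient[OF assms, of l]) (rule that)
    define d where "d = cmod (foldr dir_deriv \<xi>s (weyl_quotient \<Phi> P l) x)"
    have near: "cmod (E ((x, 0) + Y)) \<le> C * S"
      if r: "r > 0" "norm l * r \<le> 1" and Y: "norm Y \<le> real k * r" for r Y
    proof (rule tendsto_upperbound)
      let ?Y = "\<lambda>t. Y + t *\<^sub>R (v, 0)"
      show "((\<lambda>t. cmod (E ((x, 0) + Y + t *\<^sub>R (v, 0)))) \<longlongrightarrow> cmod (E ((x, 0) + Y))) (at (0::real))"
        by (intro tendsto_norm holo_tendsto_line E(1))
      \<comment> \<open>the extra unit in \<open>n = k + 1\<close> leaves room for moving to a regular point\<close>
      have "((\<lambda>t::real. norm (t *\<^sub>R (v, 0 :: 'a))) \<longlongrightarrow> norm (0 *\<^sub>R (v, 0 :: 'a))) (at 0)"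
        by (intro tendsto_intros)
      then have "\<forall>\<^sub>F t::real in at 0. norm (t *\<^sub>R (v, 0 :: 'a)) < r"
        using r(1) by (intro order_tendstoD(2)) auto
      moreover have "\<forall>\<^sub>F t::real in at 0. \<forall>\<alpha>\<in>P. cpair \<alpha> ((x, 0) + Y + t *\<^sub>R (v, 0)) \<noteq> 0"
        by (rule eventually_regular_line[OF P(2) v])
      ultimately show "\<forall>\<^sub>F t::real in at 0. cmod (E ((x, 0) + Y + t *\<^sub>R (v, 0))) \<le> C * S"
      proof eventually_elim
        case (elim t)
        have "norm (?Y t) \<le> n * r"
          using norm_triangle_ineq[of Y "t *\<^sub>R (v, 0)"] elim(1) Y by (simp add: n_def algebra_simps del: scaleR_Pair)
        then have "norm l * norm (?Y t) \<le> norm l * (n * r)" by (intro mult_left_mono) auto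
        also have "\<dots> = n * (norm l * r)" by simp
        also have "\<dots> \<le> n * 1" using r(2) by (intro mult_left_mono) (auto simp: n_def)
        finally have "cmod (E ((x, 0) + ?Y t)) \<le> C * S"
          unfolding C_def S_def using elim(2) E(2)
          by (intro quotient_estimate_regular[OF assms C0(2,1)]) (simp_all add: add.assoc del: scaleR_Pair)
        then show ?case by (simp add: add.assoc del: scaleR_Pair)
      qed
    qed simp
    have Cauchy: "d \<le> C * S / r ^ k" if "r > 0" "norm l * r \<le> 1" for r
      unfolding d_def E(3) foldr_dir_deriv_holo[OF E(1)]
      using \<xi>s(1) near[OF that] \<xi>s(2)
        iterated_Cauchy_estimate[OF E(1) that(1), where \<xi>s = \<xi>s and X = "(x, 0)" and M = "C * S"]
      by blast
    have "d \<le> C * norm l ^ k * S"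
    proof (cases "l = 0")
      case False
      then show ?thesis using Cauchy[of "1 / norm l"] by (simp add: power_one_over field_simps)
    next
      case True
      show ?thesis
      proof (cases "k = 0")
        case True
        then show ?thesis using Cauchy[of 1] \<open>l = 0\<close> by simp
      next
        case False
        \<comment> \<open>for \<open>l = 0\<close> the radius \<open>r\<close> is unrestricted, as in Liouville's theorem\<close>
        have "d \<le> 0"
        proof (rule ccontr)
          assume "\<not> d \<le> 0"
          then have d: "d > 0" by simp
          define r where "r = C * S / d + 1"
          have r: "r \<ge> 1" using d S Cpos by (simp add: r_def)
          have "d \<le> C * S / r ^ k" using Cauchy[of r] r \<open>l = 0\<close> by simp
          then have "d * r ^ k \<le> C * S" using r by (simp add: field_simps)
          moreover have "r \<le> r ^ k" using r False by (simp add: self_le_power)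
          ultimately have "d * r \<le> C * S" using d by (meson mult_le_cancel_left_pos order_trans)
          moreover have "d * r = C * S + d" using d by (simp add: r_def distrib_left)
          ultimately show False using d by linarith
        qed
        then show ?thesis using True False by (simp add: zero_power)
      qed
    qed
    then show "cmod (foldr dir_deriv \<xi>s (weyl_quotient \<Phi> P l) x)
        \<le> C * norm l ^ k * (\<Sum>w\<in>weyl_group \<Phi>. \<Prod>\<alpha>\<in>P.
             \<bar>w l \<bullet> coroot \<alpha>\<bar> / (1 + \<bar>\<alpha> \<bullet> x\<bar> * \<bar>w l \<bullet> coroot \<alpha>\<bar>))"
      by (simp only: d_def S_def)
  qed
qed

end
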